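(* Let $s$ be a fixed positive integer and let $\mathcal{M}_{n,s}=\max_{j}|t_{j,s,n}|$. Then, for all sufficiently large $n$, $$\mathcal{M}_{n,s}=e^{sKn+O(\log n)},$$ where $$K=\log 2+\max_{\frac12<w<1}\left(w^{-1}\int_0^w\log\sin(\pi t)\,dt\right)\approx 0.19861 .$$
   Context: For positive integers $s,n$, the integers $t_{j,s,n}$, $0\le j\le sn(n+1)/2$, are defined by $\prod_{k=1}^n(1-q^k)^s=\sum_{j=0}^{sn(n+1)/2}t_{j,s,n}q^j$, and the maximum is over all $0\le j\le sn(n+1)/2$. The asymptotics are as $n\to\infty$ with $s$ fixed (the implied constant may depend on $s$). *)

theory Defs
  imports
    "HOL-Analysis.Analysis"
    "HOL-Computational_Algebra.Polynomial"
    "HOL-Library.Landau_Symbols"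
begin

definition t_coeff :: "nat \<Rightarrow> nat \<Rightarrow> nat \<Rightarrow> int" where
  "t_coeff j s n = poly.coeff (\<Prod>k=1..n. (1 - monom 1 k) ^ s) j"

text \<open>The division by 2 is exact, and the product above has degree \<open>s * n * (n + 1) div 2\<close>.\<close>

definition max_coeff :: "nat \<Rightarrow> nat \<Rightarrow> int" where
  "max_coeff n s = (MAX j\<in>{0..s * n * (n + 1) div 2}. \<bar>t_coeff j s n\<bar>)"

text \<open>The integrand has an integrable singularity at \<open>0\<close>, where its value is
  irrelevant (in HOL, \<open>ln 0 = 0\<close>); on \<open>(0, 1)\<close> the sine is positive.\<close>

definition mean_log_sin :: "real \<Rightarrow> real" where
  "mean_log_sin w = inverse w * integral {0..w} (\<lambda>t. ln (sin (pi * t)))"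

text \<open>\<open>GREATEST\<close> denotes the maximum of the image only if that maximum exists;
  its existence has to be stated separately.\<close>

definition K_const :: real where
  "K_const = ln 2 + (GREATEST y. y \<in> mean_log_sin ` {1/2<..<1})"

end

theory Submission
  imports Defs "HOL-Real_Asymp.Real_Asymp"
begin

text \<open>
  Up to a polynomial factor in \<open>n\<close>, the largest coefficient of a polynomial of degree
  \<open>s n (n + 1) / 2\<close> is its maximum modulus on the unit circle, so everything reduces to the maximum over
  \<open>t\<close> of \<open>F t = (\<Sum>k = 1..n. ln \<bar>2 sin (pi k t)\<bar>)\<close>. With \<open>t = w / n\<close> this is a Riemann sum of the
  function \<open>ln (2 sin (pi x))\<close>, concave on \<open>(0, 1)\<close>: the midpoint rule gives the lower bound
  \<open>K n - O(1)\<close>.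

  For the upper bound, if \<open>n t\<close> is bounded, the trapezoid rule bounds the sum over each of the boundedly
  many turns of the circle by \<open>K\<close> times its number of terms plus \<open>O(ln n)\<close>. If \<open>n t\<close> is large, then
  \<open>ln \<bar>2 sin (pi x)\<bar>\<close> is replaced by a majorant that is a trigonometric polynomial of degree 5; the cosine
  sums of order \<open>m\<close> are negligible unless \<open>m t\<close> is close to an integer, and are never much smaller
  than \<open>-0.2172 n\<close>, which leaves a bound strictly below \<open>K n\<close>.

  The maximum point of the mean satisfies \<open>w ln (sin (pi w)) = integral {0..w} (ln sin (pi x))\<close>, whence
  \<open>K = ln (2 sin (pi w))\<close>; this is evaluated with the product formula of the cosine.
\<close>

section \<open>The integral of \<open>ln (sin (pi t))\<close>\<close>

definition log_sin :: "real \<Rightarrow> real" where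
  "log_sin t = ln (sin (pi * t))"

definition log_sin_int :: "real \<Rightarrow> real" where
  "log_sin_int w = integral {0..w} log_sin"

lemma sin_pi_pos: "0 < t \<Longrightarrow> t < 1 \<Longrightarrow> 0 < sin (pi * t)"
  by (rule sin_gt_zero) auto

lemma log_sin_le_0: "0 < t \<Longrightarrow> t < 1 \<Longrightarrow> log_sin t \<le> 0"
  unfolding log_sin_def using sin_pi_pos[of t] by (subst ln_le_zero_iff) auto

lemma log_sin_reflect: "log_sin (1 - t) = log_sin t"
proof -
  have "sin (pi * (1 - t)) = sin (pi - pi * t)" by (simp add: algebra_simps)
  then show ?thesis unfolding log_sin_def by simp
qed

text \<open>Duplication formula of the sine, with the cosine read as the sine of the complementary
  angle. Integrated, it determines \<open>log_sin_int (1/2)\<close>.\<close>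

lemma log_sin_double:
  assumes "0 < t" "t < 1/2"
  shows "log_sin (2 * t) = ln 2 + log_sin t + log_sin (1/2 - t)"
proof -
  have "sin (pi * (2 * t)) = 2 * sin (pi * t) * sin (pi * (1/2 - t))"
    using sin_double[of "pi * t"] sin_cos_eq[of "pi * (1/2 - t)"]
    by (simp add: algebra_simps)
  moreover have "0 < sin (pi * t)" "0 < sin (pi * (1/2 - t))"
    using assms by (auto intro!: sin_pi_pos)
  ultimately show ?thesis unfolding log_sin_def by (simp add: ln_mult)
qed

lemma has_field_derivative_log_sin:
  assumes "0 < t" "t < 1"
  shows "(log_sin has_real_derivative pi * cot (pi * t)) (at t)"
  unfolding log_sin_def using sin_pi_pos[OF assms]
  by (auto intro!: derivative_eq_intros simp: cot_def)

lemma continuous_on_mult_ln_minus: "continuous_on {0..b} (\<lambda>w::real. w * ln w - w)"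
proof (unfold continuous_on_def, rule ballI)
  fix x assume x: "x \<in> {0..b}"
  show "((\<lambda>w. w * ln w - w) \<longlongrightarrow> x * ln x - x) (at x within {0..b})"
  proof (cases "x = 0")
    case True
    \<comment> \<open>With \<open>ln 0 = 0\<close> the value at 0 is 0, which is also the limit from
      the right.\<close>
    have "((\<lambda>w::real. w * ln w - w) \<longlongrightarrow> 0) (at_right 0)" by real_asymp
    moreover have "at 0 within {0..b} \<le> at_right (0::real)"
      unfolding at_within_def by (intro inf_mono) auto
    ultimately show ?thesis using True filterlim_mono by fastforce
  qed (use x in \<open>auto intro!: tendsto_eq_intros\<close>)
qed

text \<open>The singularity at \<open>0\<close> is that of \<open>ln\<close>, which has the continuous antiderivative \<open>w * ln w - w\<close>.\<close>

lemma log_sin_integrable: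
  assumes "0 \<le> b" "b < 1"
  shows "log_sin integrable_on {0..b}"
proof -
  \<comment> \<open>\<open>r\<close> is the continuous extension of \<open>sin (pi * t) / t\<close>,
    positive on [0, 1), so that \<open>log_sin t = ln t + ln (r t)\<close> on (0, 1) isolates the
    singularity.\<close>
  define r where "r t = (if t = 0 then pi else sin (pi * t) / t)" for t :: real
  have "isCont r t" for t
  proof (cases "t = 0")
    case True
    have "((\<lambda>t. sin (pi * t) / t) \<longlongrightarrow> pi) (at 0)" by real_asymp
    then have "(r \<longlongrightarrow> pi) (at 0)"
      by (rule Lim_transform_eventually) (auto simp: r_def eventually_at_filter)
    then show ?thesis using True by (simp add: isCont_def r_def)
  next
    case False
    then have "eventually (\<lambda>x. r x = sin (pi * x) / x) (nhds t)"
      by (auto simp: r_def intro!: eventually_mono[OF t1_space_nhds])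
    then show ?thesis using False by (subst isCont_cong) auto
  qed
  then have r_cont: "continuous_on S r" for S by (simp add: continuous_at_imp_continuous_on)
  have r_pos: "0 < r t" if "0 \<le> t" "t < 1" for t
    using that sin_pi_pos[of t] by (auto simp: r_def)
  have lr: "continuous_on {0..b} (\<lambda>t. ln (r t))"
    using assms r_pos by (intro continuous_on_ln r_cont) (force simp: less_le)
  define A where "A w = (w * ln w - w) + integral {0..w} (\<lambda>t. ln (r t))" for w
  \<comment> \<open>This form of the fundamental theorem asks for the derivative in the open
    interval only; at 0 the continuity of \<open>A\<close> suffices.\<close>
  have "(log_sin has_integral (A b - A 0)) {0..b}"
  proof (rule fundamental_theorem_of_calculus_interior)
    show "continuous_on {0..b} A"
      unfolding A_def
      by (intro continuous_on_add continuous_on_mult_ln_minus indefinite_integral_continuous_1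
            integrable_continuous_interval lr)
    fix x assume x: "x \<in> {0<..<b}"
    have "((\<lambda>w. integral {0..w} (\<lambda>t. ln (r t))) has_real_derivative ln (r x)) (at x within {0..b})"
      using integral_has_real_derivative[OF lr, of x] x by auto
    then have "((\<lambda>w. integral {0..w} (\<lambda>t. ln (r t))) has_real_derivative ln (r x)) (at x)"
      using x at_within_Icc_at[of 0 x b] by auto
    moreover have "((\<lambda>w. w * ln w - w) has_real_derivative ln x) (at x)"
      using x by (auto intro!: derivative_eq_intros)
    ultimately have "(A has_real_derivative (ln x + ln (r x))) (at x)"
      unfolding A_def using DERIV_add by blast
    moreover have "ln x + ln (r x) = log_sin x"
      using x assms r_pos[of x] sin_pi_pos[of x] unfolding log_sin_def r_def
      by (simp add: ln_div)
    ultimately show "(A has_vector_derivative log_sin x) (at x)"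
      by (simp add: has_real_derivative_iff_has_vector_derivative)
  qed (use assms in auto)
  then show ?thesis by auto
qed

lemma log_sin_int_0 [simp]: "log_sin_int 0 = 0"
  by (simp add: log_sin_int_def)

lemma continuous_on_log_sin_int: "b < 1 \<Longrightarrow> continuous_on {0..b} log_sin_int"
  unfolding log_sin_int_def
  by (cases "0 \<le> b") (auto intro!: indefinite_integral_continuous_1 log_sin_integrable)

lemma DERIV_log_sin_int:
  assumes "0 < x" "x < 1"
  shows "(log_sin_int has_real_derivative log_sin x) (at x)"
proof -
  \<comment> \<open>Integrability is available on intervals ending before 1, so an endpoint strictly
    between \<open>x\<close> and 1 is chosen.\<close>
  define b where "b = (x + 1) / 2"
  have b: "x < b" "b < 1" "0 \<le> b" using assms by (auto simp: b_def)
  have "isCont log_sin x"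
    using has_field_derivative_log_sin[OF assms] by (rule DERIV_isCont)
  then have "(log_sin_int has_vector_derivative log_sin x) (at x within {0..b} - {})"
    unfolding log_sin_int_def using b assms
    by (intro integral_has_vector_derivative_continuous_at log_sin_integrable)
       (auto simp: continuous_at_imp_continuous_within)
  then show ?thesis
    using b assms at_within_Icc_at[of 0 x b]
    by (simp add: has_real_derivative_iff_has_vector_derivative)
qed

lemma isCont_log_sin_int: "0 < x \<Longrightarrow> x < 1 \<Longrightarrow> isCont log_sin_int x"
  using DERIV_log_sin_int DERIV_isCont by blast

text \<open>The duplication formula makes
  \<open>J (2 w) / 2 - J w + J (1/2 - w)\<close> constant for the integral \<open>J\<close> of \<open>ln (2 sin (pi t))\<close>;
  its values at \<open>0\<close> and \<open>1/4\<close> are \<open>J (1/2)\<close> and \<open>J (1/2) / 2\<close>.\<close>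

lemma log_sin_int_half: "log_sin_int (1/2) = - ln 2 / 2"
proof -
  define D where "D w = log_sin_int (2 * w) / 2 - log_sin_int w + log_sin_int (1/2 - w)
      - w * ln 2" for w
  have c: "continuous_on {0..1/4} D"
    unfolding D_def
    by (intro continuous_intros continuous_on_compose2[OF continuous_on_log_sin_int[of "1/2"]]) auto
  have "D (1/4) = D 0"
  proof (rule DERIV_isconst2[of 0 "1/4"])
    fix x :: real assume x: "0 < x" "x < 1/4"
    have 1: "((\<lambda>w. log_sin_int (2 * w)) has_real_derivative log_sin (2 * x) * 2) (at x)"
      by (rule DERIV_chain2[OF DERIV_log_sin_int]) (use x in \<open>auto intro!: derivative_eq_intros\<close>)
    have 2: "((\<lambda>w. log_sin_int (1/2 - w)) has_real_derivative log_sin (1/2 - x) * (-1)) (at x)"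
      by (rule DERIV_chain2[OF DERIV_log_sin_int]) (use x in \<open>auto intro!: derivative_eq_intros\<close>)
    have 3: "(log_sin_int has_real_derivative log_sin x) (at x)"
      by (rule DERIV_log_sin_int) (use x in auto)
    have "((\<lambda>w. w * ln 2) has_real_derivative ln 2) (at x)"
      by (auto intro!: derivative_eq_intros)
    then have "(D has_real_derivative
        (log_sin (2 * x) * 2 / 2 - log_sin x + log_sin (1/2 - x) * (-1) - ln 2)) (at x)"
      unfolding D_def by (intro DERIV_diff DERIV_add DERIV_cdivide 1 2 3)
    moreover have "log_sin (2 * x) * 2 / 2 - log_sin x + log_sin (1/2 - x) * (-1) - ln 2 = 0"
      using log_sin_double[of x] x by (simp add: field_simps)
    ultimately show "(D has_real_derivative 0) (at x)" by simp
  qed (use c in auto)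
  then show ?thesis by (simp add: D_def)
qed

section \<open>Concavity of \<open>log_sin\<close> and the quadrature inequalities\<close>

text \<open>Concavity from the identity sin(a+b) sin(a-b) = sin(a)^2 - sin(b)^2, whose right side is
  at most sin(a)^2.\<close>

lemma log_sin_midpoint:
  assumes "0 < c - u" "c + u < 1" "0 \<le> u"
  shows "log_sin (c + u) + log_sin (c - u) \<le> 2 * log_sin c"
proof -
  have pos: "0 < sin (pi * (c + u))" "0 < sin (pi * (c - u))" "0 < sin (pi * c)"
    using assms by (auto intro!: sin_pi_pos)
  have "sin (pi * (c + u)) * sin (pi * (c - u))
      = (sin (pi * c))\<^sup>2 * (cos (pi * u))\<^sup>2 - (cos (pi * c))\<^sup>2 * (sin (pi * u))\<^sup>2"
    unfolding ring_distribs sin_add sin_diff by (simp add: power2_eq_square algebra_simps)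
  also have "\<dots> = (sin (pi * c))\<^sup>2 - (sin (pi * u))\<^sup>2"
    unfolding cos_squared_eq by (simp add: algebra_simps)
  also have "\<dots> \<le> (sin (pi * c))\<^sup>2" by simp
  finally have "ln (sin (pi * (c + u)) * sin (pi * (c - u))) \<le> ln ((sin (pi * c))\<^sup>2)"
    using pos by (subst ln_le_cancel_iff) auto
  then show ?thesis using pos by (simp add: log_sin_def ln_mult ln_realpow)
qed

text \<open>After clearing denominators the difference is \<open>sin (pi * b - pi * a)\<close>.
  Since \<open>pi * cot (pi * t)\<close> is the derivative of \<open>log_sin\<close>, this is
  concavity in differential form.\<close>

lemma cot_pi_antimono:
  assumes "0 < a" "a \<le> b" "b < 1"
  shows "cot (pi * b) \<le> cot (pi * a)"
proof -
  have pos: "0 < sin (pi * a)" "0 < sin (pi * b)" using assms by (auto intro!: sin_pi_pos)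
  have "0 \<le> sin (pi * b - pi * a)"
    using assms by (intro sin_ge_zero) (auto simp flip: right_diff_distrib intro: mult_left_le)
  then show ?thesis using pos
    by (simp add: cot_def sin_diff field_simps)
qed

text \<open>One half of the Hermite-Hadamard inequality. As a function of the half-width, the
  difference of the two sides has the defect in \<open>log_sin_midpoint\<close> as its
  derivative.\<close>

lemma log_sin_int_midpoint:
  assumes "0 \<le> u" "0 < c - u" "c + u < 1"
  shows "log_sin_int (c + u) - log_sin_int (c - u) \<le> 2 * u * log_sin c"
proof -
  define P where "P u = 2 * u * log_sin c - (log_sin_int (c + u) - log_sin_int (c - u))" for u
  have "P 0 \<le> P u"
  proof (rule DERIV_nonneg_imp_nondecreasing[OF assms(1)])
    fix x assume x: "0 \<le> x" "x \<le> u"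
    have 1: "((\<lambda>w. log_sin_int (c + w)) has_real_derivative log_sin (c + x) * 1) (at x)"
      by (rule DERIV_chain2[OF DERIV_log_sin_int]) (use x assms in \<open>auto intro!: derivative_eq_intros\<close>)
    have 2: "((\<lambda>w. log_sin_int (c - w)) has_real_derivative log_sin (c - x) * (-1)) (at x)"
      by (rule DERIV_chain2[OF DERIV_log_sin_int]) (use x assms in \<open>auto intro!: derivative_eq_intros\<close>)
    have "((\<lambda>u. 2 * u * log_sin c) has_real_derivative 2 * log_sin c) (at x)"
      by (auto intro!: derivative_eq_intros)
    then have "(P has_real_derivative
        (2 * log_sin c - (log_sin (c + x) * 1 - log_sin (c - x) * (-1)))) (at x)"
      unfolding P_def by (intro DERIV_diff 1 2)
    then have "(P has_real_derivative (2 * log_sin c - (log_sin (c + x) + log_sin (c - x)))) (at x)"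
      by simp
    moreover have "2 * log_sin c - (log_sin (c + x) + log_sin (c - x)) \<ge> 0"
      using log_sin_midpoint[of c x] x assms by simp
    ultimately show "\<exists>y. (P has_real_derivative y) (at x) \<and> 0 \<le> y" by blast
  qed
  then show ?thesis by (simp add: P_def)
qed

text \<open>The other half of Hermite-Hadamard. With the centre fixed, the difference of the two
  sides has as derivative in the half-width \<open>x\<close> the product of \<open>x\<close> and the
  drop of \<open>pi * cot\<close> across the interval.\<close>

lemma log_sin_int_trapezoid:
  assumes "0 < a" "a \<le> b" "b < 1"
  shows "(b - a) * (log_sin a + log_sin b) / 2 \<le> log_sin_int b - log_sin_int a"
proof -
  define c where "c = (a + b) / 2"
  define v where "v = (b - a) / 2"
  have cv: "0 \<le> v" "0 < c - v" "c + v < 1" "c + v = b" "c - v = a" "b - a = 2 * v"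
    using assms by (auto simp: c_def v_def field_simps)
  define P where "P u = (log_sin_int (c + u) - log_sin_int (c - u))
      - u * (log_sin (c + u) + log_sin (c - u))" for u
  have "P 0 \<le> P v"
  proof (rule DERIV_nonneg_imp_nondecreasing[OF cv(1)])
    fix x assume x: "0 \<le> x" "x \<le> v"
    then have x': "0 < c - x" "c - x < 1" "0 < c + x" "c + x < 1" using cv by auto
    have 1: "((\<lambda>w. log_sin_int (c + w)) has_real_derivative log_sin (c + x) * 1) (at x)"
      by (rule DERIV_chain2[OF DERIV_log_sin_int]) (use x' in \<open>auto intro!: derivative_eq_intros\<close>)
    have 2: "((\<lambda>w. log_sin_int (c - w)) has_real_derivative log_sin (c - x) * (-1)) (at x)"
      by (rule DERIV_chain2[OF DERIV_log_sin_int]) (use x' in \<open>auto intro!: derivative_eq_intros\<close>)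
    have 3: "((\<lambda>w. log_sin (c + w)) has_real_derivative pi * cot (pi * (c + x)) * 1) (at x)"
      by (rule DERIV_chain2[OF has_field_derivative_log_sin])
         (use x' in \<open>auto intro!: derivative_eq_intros\<close>)
    have 4: "((\<lambda>w. log_sin (c - w)) has_real_derivative pi * cot (pi * (c - x)) * (-1)) (at x)"
      by (rule DERIV_chain2[OF has_field_derivative_log_sin])
         (use x' in \<open>auto intro!: derivative_eq_intros\<close>)
    have "(P has_real_derivative (log_sin (c + x) * 1 - log_sin (c - x) * (-1)
        - (1 * (log_sin (c + x) + log_sin (c - x))
           + (pi * cot (pi * (c + x)) * 1 + pi * cot (pi * (c - x)) * (-1)) * x))) (at x)"
      unfolding P_def by (intro DERIV_diff DERIV_mult DERIV_add DERIV_ident 1 2 3 4)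
    then have "(P has_real_derivative (x * pi * (cot (pi * (c - x)) - cot (pi * (c + x))))) (at x)"
      by (simp add: algebra_simps)
    moreover have "x * pi * (cot (pi * (c - x)) - cot (pi * (c + x))) \<ge> 0"
      using cot_pi_antimono[of "c - x" "c + x"] x x' by simp
    ultimately show "\<exists>y. (P has_real_derivative y) (at x) \<and> 0 \<le> y" by blast
  qed
  then have "v * (log_sin b + log_sin a) \<le> log_sin_int b - log_sin_int a"
    using cv by (simp add: P_def)
  then show ?thesis by (simp add: cv(6) mult.assoc add.commute)
qed

lemma log_sin_antimono:
  assumes "1/2 \<le> a" "a \<le> b" "b < 1"
  shows "log_sin b \<le> log_sin a"
proof -
  have "cos (pi * (b - 1/2)) \<le> cos (pi * (a - 1/2))"
    by (rule cos_monotone_0_pi_le)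
       (use assms in \<open>auto intro!: mult_left_mono mult_left_le\<close>)
  then have "sin (pi * b) \<le> sin (pi * a)"
    using sin_cos_eq[of "pi * b"] sin_cos_eq[of "pi * a"] cos_minus[of "pi * (b - 1/2)"]
      cos_minus[of "pi * (a - 1/2)"]
    by (simp add: algebra_simps)
  moreover have "0 < sin (pi * b)" using assms by (intro sin_pi_pos) auto
  ultimately show ?thesis unfolding log_sin_def by (subst ln_le_cancel_iff) auto
qed

text \<open>On [1/2, 1) the derivative \<open>log_sin\<close> decreases, so
  \<open>log_sin_int\<close> is concave there and lies below its tangents.\<close>

lemma log_sin_int_tangent:
  assumes a: "1/2 \<le> a" "a < 1" and w: "1/2 \<le> w" "w < 1"
  shows "log_sin_int w \<le> log_sin_int a + log_sin a * (w - a)"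
proof -
  have mvt: "\<exists>z. x < z \<and> z < y \<and> log_sin_int y - log_sin_int x = (y - x) * log_sin z"
    if "1/2 \<le> x" "x < y" "y < 1" for x y
    using MVT2[of x y log_sin_int log_sin] that DERIV_log_sin_int by force
  consider "a < w" | "a = w" | "w < a" by linarith
  then show ?thesis
  proof cases
    case 1
    then obtain z where z: "a < z" "z < w" "log_sin_int w - log_sin_int a = (w - a) * log_sin z"
      using mvt[of a w] assms by auto
    have "(w - a) * log_sin z \<le> (w - a) * log_sin a"
      using z 1 assms by (intro mult_left_mono log_sin_antimono) auto
    then show ?thesis using z by (metis add.commute diff_le_eq mult.commute)
  next
    case 3
    then obtain z where z: "w < z" "z < a" "log_sin_int a - log_sin_int w = (a - w) * log_sin z"
      using mvt[of w a] assms by auto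
    have "(a - w) * log_sin a \<le> (a - w) * log_sin z"
      using z 3 assms by (intro mult_left_mono log_sin_antimono) auto
    then show ?thesis using z by (simp add: algebra_simps)
  qed auto
qed

lemma log_sin_int_antimono:
  assumes "0 < a" "a \<le> b" "b < 1"
  shows "log_sin_int b \<le> log_sin_int a"
proof -
  have "- log_sin_int a \<le> - log_sin_int b"
  proof (rule DERIV_nonneg_imp_nondecreasing[OF assms(2)])
    fix x assume x: "a \<le> x" "x \<le> b"
    have "((\<lambda>x. - log_sin_int x) has_real_derivative - log_sin x) (at x)"
      by (intro DERIV_minus DERIV_log_sin_int) (use x assms in auto)
    then show "\<exists>y. ((\<lambda>x. - log_sin_int x) has_real_derivative y) (at x) \<and> 0 \<le> y"
      using log_sin_le_0[of x] x assms by force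
  qed
  then show ?thesis by simp
qed

text \<open>Monotonicity on both sides of \<open>1/6\<close>, where \<open>2 sin (pi t) = 1\<close>.\<close>

lemma log_sin_int_le_first_half:
  assumes "0 \<le> w" "w \<le> 1/2"
  shows "log_sin_int w + w * ln 2 \<le> 0"
proof -
  define J where "J w = log_sin_int w + w * ln 2" for w
  have J: "(J has_real_derivative (log_sin x + ln 2)) (at x)" if "0 < x" "x < 1" for x
    unfolding J_def using DERIV_log_sin_int[OF that] by (auto intro!: derivative_eq_intros)
  have s: "log_sin x + ln 2 = ln (2 * sin (pi * x))" if "0 < x" "x < 1" for x
    using sin_pi_pos[OF that] by (simp add: log_sin_def ln_mult)
  have Jc: "continuous_on {0..1/2} J"
    unfolding J_def by (intro continuous_intros continuous_on_log_sin_int) auto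
  have J0: "J 0 = 0" "J (1/2) = 0" by (auto simp: J_def log_sin_int_half)
  have s6: "sin (pi * (1/6)) = 1/2" using sin_30 by simp
  show ?thesis
  proof (cases "w \<le> 1/6")
    case True
    have "J w \<le> J 0"
    proof (rule DERIV_nonpos_imp_decreasing_open[OF assms(1)])
      show "continuous_on {0..w} J" by (rule continuous_on_subset[OF Jc]) (use assms in auto)
      fix x assume x: "0 < x" "x < w"
      have "- (pi / 2) \<le> 0" "0 \<le> pi * x" using x by auto
      then have "- (pi / 2) \<le> pi * x" by linarith
      then have "sin (pi * x) \<le> sin (pi * (1/6))"
        using x True by (intro sin_monotone_2pi_le) auto
      then have "ln (2 * sin (pi * x)) \<le> 0"
        using s6 sin_pi_pos[of x] x assms by (subst ln_le_zero_iff) auto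
      then show "\<exists>y. (J has_real_derivative y) (at x) \<and> y \<le> 0"
        using J[of x] s[of x] x assms by force
    qed
    then show ?thesis using J0 by (simp add: J_def)
  next
    case False
    have "J w \<le> J (1/2)"
    proof (rule DERIV_nonneg_imp_nondecreasing[OF assms(2)])
      fix x assume x: "w \<le> x" "x \<le> 1/2"
      have "sin (pi * (1/6)) \<le> sin (pi * x)"
        using x False by (intro sin_monotone_2pi_le) (auto simp: field_simps)
      then have "ln (2 * sin (pi * x)) \<ge> 0"
        using s6 by (subst ln_ge_zero_iff) auto
      then show "\<exists>y. (J has_real_derivative y) (at x) \<and> 0 \<le> y"
        using J[of x] s[of x] x assms False by force
    qed
    then show ?thesis using J0 by (simp add: J_def)
  qed
qed

section \<open>The maximum of the mean, and the lower bound\<close>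

lemma mean_log_sin_eq: "mean_log_sin w = log_sin_int w / w"
  by (simp add: mean_log_sin_def log_sin_int_def log_sin_def[abs_def] divide_inverse mult.commute)

lemma log_sin_half [simp]: "log_sin (1/2) = 0"
  by (simp add: log_sin_def)

text \<open>The derivative of \<open>log_sin_int w / w\<close> vanishes exactly when \<open>w * log_sin w = log_sin_int w\<close>.\<close>

lemma stationary_point_exists:
  obtains w where "1/2 < w" "w < 9/10" "w * log_sin w = log_sin_int w"
proof -
  define C where "C w = w * log_sin w - log_sin_int w" for w
  have "isCont log_sin x" if "0 < x" "x < 1" for x
    using DERIV_isCont[OF has_field_derivative_log_sin[OF that]] .
  then have cont: "\<forall>x. 1/2 \<le> x \<and> x \<le> 9/10 \<longrightarrow> isCont C x"
    unfolding C_def by (auto intro!: continuous_intros isCont_log_sin_int)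
  have "0 < ln (2::real)" by simp
  have half: "0 < C (1/2)" by (simp add: C_def log_sin_int_half)
  \<comment> \<open>The sign at 9/10: \<open>log_sin (9/10)\<close> is at most
    \<open>- ln 2\<close>, and with the trapezoid bound for the integral over [1/2, 9/10] this gives
    \<open>C (9/10)\<close> at most \<open>- ln 2 / 5\<close>.\<close>
  have "sin (pi * (1/10)) \<le> pi * (1/10)" by (rule sin_x_le_x) simp
  also have "\<dots> < 1/2" using pi_less_4 by simp
  finally have "ln (sin (pi * (1/10))) \<le> ln (1/2)"
    using sin_pi_pos[of "1/10"] by (subst ln_le_cancel_iff) auto
  then have "log_sin (9/10) \<le> - ln 2"
    using log_sin_reflect[of "1/10"] by (simp add: log_sin_def ln_div)
  moreover have "log_sin (9/10) / 5 \<le> log_sin_int (9/10) + ln 2 / 2"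
    using log_sin_int_trapezoid[of "1/2" "9/10"] by (simp add: log_sin_int_half)
  ultimately have end9: "C (9/10) < 0"
    using \<open>0 < ln 2\<close> unfolding C_def by linarith
  obtain w where w: "1/2 \<le> w" "w \<le> 9/10" "C w = 0"
    using IVT2[of C "9/10" 0 "1/2"] half end9 cont by auto
  then have "w \<noteq> 1/2" "w \<noteq> 9/10" using half end9 by force+
  then show thesis using that[of w] w by (auto simp: C_def)
qed

text \<open>The tangent at a stationary point passes through the origin, so its value at 1/2 is
  \<open>log_sin w / 2\<close>; by concavity this is at least
  \<open>log_sin_int (1/2)\<close>.\<close>

lemma log_sin_ge_at_stationary:
  assumes "1/2 < w" "w < 1" "w * log_sin w = log_sin_int w"
  shows "- ln 2 \<le> log_sin w"
  using log_sin_int_tangent[of w "1/2"] assms by (simp add: log_sin_int_half algebra_simps)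

text \<open>The right side is the tangent at \<open>w\<close>. On [1/2, 1) concavity applies; on
  [0, 1/2] the integral is at most \<open>- ln 2 * v\<close>, which the slope bound keeps below the
  tangent.\<close>

lemma stationary_is_max:
  assumes w: "1/2 < w" "w < 1" "w * log_sin w = log_sin_int w" and v: "0 \<le> v" "v < 1"
  shows "log_sin_int v \<le> log_sin w * v"
proof (cases "v \<le> 1/2")
  case True
  then have "log_sin_int v \<le> - ln 2 * v"
    using log_sin_int_le_first_half[of v] v by (simp add: mult.commute)
  also have "\<dots> \<le> log_sin w * v"
    using log_sin_ge_at_stationary[OF w] v by (intro mult_right_mono) auto
  finally show ?thesis .
next
  case False
  then show ?thesis using log_sin_int_tangent[of w v] w v by (simp add: algebra_simps)
qed

lemma max_point_exists:
  obtains w where "1/2 < w" "w < 9/10" "w * log_sin w = log_sin_int w"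
    "K_const = ln 2 + log_sin w" "mean_log_sin w = log_sin w"
    "\<And>v. v \<in> {1/2<..<1} \<Longrightarrow> mean_log_sin v \<le> mean_log_sin w"
proof -
  obtain w where w: "1/2 < w" "w < 9/10" "w * log_sin w = log_sin_int w"
    by (rule stationary_point_exists)
  then have mean_w: "mean_log_sin w = log_sin w" by (simp add: mean_log_sin_eq field_simps)
  have max: "mean_log_sin v \<le> mean_log_sin w" if "v \<in> {1/2<..<1}" for v
    using stationary_is_max[of w v] w that
    by (simp add: mean_w) (simp add: mean_log_sin_eq divide_le_eq)
  have "(GREATEST y. y \<in> mean_log_sin ` {1/2<..<1}) = mean_log_sin w"
    using w max by (intro Greatest_equality) auto
  then show thesis using that w mean_w max by (auto simp: K_const_def)
qed

text \<open>The range is all of [0, 1), not just the interval over which the maximum is taken,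
  because a turn of the circle may end anywhere.\<close>

lemma log_sin_int_le_K:
  assumes "0 \<le> v" "v < 1"
  shows "log_sin_int v + v * ln 2 \<le> K_const * v"
proof -
  obtain w where w: "1/2 < w" "w < 9/10" "w * log_sin w = log_sin_int w"
    "K_const = ln 2 + log_sin w" by (rule max_point_exists) blast
  then show ?thesis
    using stationary_is_max[of w v] assms unfolding w(4) by (simp add: algebra_simps)
qed

text \<open>A certificate for upper bounds: the last hypothesis says that the mean has nonnegative
  derivative at \<open>a\<close>. The tangent at \<open>a\<close>, evaluated at the maximum point,
  then compares the two slopes.\<close>

lemma K_const_upper:
  assumes "1/2 \<le> a" "a < 1" "log_sin_int a \<le> a * log_sin a"
  shows "K_const \<le> ln 2 + log_sin a"
proof -
  obtain w where w: "1/2 < w" "w < 9/10" "w * log_sin w = log_sin_int w"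
    "K_const = ln 2 + log_sin w" by (rule max_point_exists) blast
  have "w * log_sin w \<le> w * log_sin a"
    using log_sin_int_tangent[of a w] assms w by (simp add: algebra_simps)
  then have "log_sin w \<le> log_sin a" by (rule mult_left_le_imp_le) (use w in auto)
  then show ?thesis using w by simp
qed

section \<open>Lower bound for the sine product at the maximum point\<close>

text \<open>Cells of width \<open>h = w / n\<close> centred at \<open>k * h\<close>,
  \<open>k < n\<close>, cover [h/2, w - h/2]. The factor at \<open>w\<close> itself is kept apart
  and yields \<open>sin (pi * w)\<close>.\<close>

lemma prod_sin_lower_bound:
  obtains w where "1/2 < w" "w < 9/10" "0 < sin (pi * w)"
    "\<And>n. n > 0 \<Longrightarrow> exp (K_const * real n) * sin (pi * w)
        \<le> (\<Prod>k=1..n. 2 * sin (pi * (real k * (w / real n))))"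
proof -
  obtain w where w: "1/2 < w" "w < 9/10" "w * log_sin w = log_sin_int w"
    "K_const = ln 2 + log_sin w" by (rule max_point_exists) blast
  have "exp (K_const * real n) * sin (pi * w) \<le> (\<Prod>k=1..n. 2 * sin (pi * (real k * (w / real n))))"
    if n: "n > 0" for n
  proof -
    define h where "h = w / real n"
    have h: "0 < h" "real n * h = w" using w n by (auto simp: h_def)
    have inside: "0 < real k * h" "real k * h < 1" if "k \<in> {1..n}" for k
    proof -
      have "real k * h \<le> real n * h" using that h by (intro mult_right_mono) auto
      then show "0 < real k * h" "real k * h < 1" using that h w by auto
    qed
    have partial: "log_sin_int ((real m + 1/2) * h) - log_sin_int (h / 2)
        \<le> h * (\<Sum>k=1..m. log_sin (real k * h))" if "m < n" for m
      using that
    proof (induction m)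
      case (Suc m)
      have "(real (Suc m) + 1) * h \<le> real n * h"
        using Suc.prems h by (intro mult_right_mono) auto
      then have b: "real (Suc m) * h + h \<le> w" using h by (simp add: algebra_simps)
      have pos: "0 < real m * h + h / 2" using h by (intro add_nonneg_pos) auto
      have "log_sin_int (real (Suc m) * h + h/2) - log_sin_int (real (Suc m) * h - h/2)
          \<le> 2 * (h/2) * log_sin (real (Suc m) * h)"
        by (rule log_sin_int_midpoint) (use h b w pos in \<open>auto simp: algebra_simps\<close>)
      moreover have "real (Suc m) * h + h/2 = (real (Suc m) + 1/2) * h"
        "real (Suc m) * h - h/2 = (real m + 1/2) * h" by (auto simp: algebra_simps)
      ultimately show ?case using Suc by (simp add: distrib_left)
    qed simp
    have le_w: "(real (n - 1) + 1/2) * h \<le> w"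
      using h n by (simp add: of_nat_diff algebra_simps)
    \<comment> \<open>The two missing half cells only help: \<open>log_sin_int\<close> decreases, so
      stopping before \<open>w\<close> gives more, and \<open>log_sin_int (h / 2)\<close> is at most
      0.\<close>
    have "log_sin_int w \<le> log_sin_int ((real (n - 1) + 1/2) * h)"
      by (rule log_sin_int_antimono) (use h w le_w in auto)
    moreover have "h / 2 \<le> w / 2" using h(2) h(1) n
      by (simp add: h_def field_simps)
    then have "log_sin_int (h / 2) + h / 2 * ln 2 \<le> 0"
      by (intro log_sin_int_le_first_half) (use h w in auto)
    then have "log_sin_int (h / 2) \<le> 0" using h by (smt (verit) divide_pos_pos ln_gt_zero mult_pos_pos)
    ultimately have "log_sin_int w \<le> h * (\<Sum>k=1..n-1. log_sin (real k * h))"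
      using partial[of "n - 1"] n by auto
    \<comment> \<open>Stationarity of \<open>w\<close> turns the integral into \<open>n\<close>
      equal terms \<open>log_sin w\<close>, that is \<open>K_const - ln 2\<close> each.\<close>
    moreover have "log_sin_int w = real n * log_sin w * h"
      using w(3) h(2) by (metis mult.assoc mult.commute)
    ultimately have "real n * log_sin w * h \<le> (\<Sum>k=1..n-1. log_sin (real k * h)) * h"
      by (simp add: mult.commute)
    then have "real n * log_sin w \<le> (\<Sum>k=1..n-1. log_sin (real k * h))"
      using h by simp
    moreover have "(\<Sum>k=1..n. log_sin (real k * h)) = (\<Sum>k=1..n-1. log_sin (real k * h)) + log_sin w"
      using n h by (cases n) auto
    ultimately have "K_const * real n + log_sin w \<le> (\<Sum>k=1..n. ln 2 + log_sin (real k * h))"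
      unfolding w(4) by (simp add: sum.distrib algebra_simps)
    then have "exp (K_const * real n + log_sin w) \<le> exp (\<Sum>k=1..n. ln 2 + log_sin (real k * h))"
      by simp
    also have "\<dots> = (\<Prod>k=1..n. exp (ln 2 + log_sin (real k * h)))"
      by (simp add: exp_sum)
    also have "\<dots> = (\<Prod>k=1..n. 2 * sin (pi * (real k * h)))"
      by (intro prod.cong refl)
         (use inside sin_pi_pos in \<open>auto simp: exp_add log_sin_def\<close>)
    finally show ?thesis
      using sin_pi_pos[of w] w by (simp add: exp_add log_sin_def h_def)
  qed
  then show thesis using that w sin_pi_pos[of w] by auto
qed

section \<open>Numerical value of the constant\<close>

text \<open>The even terms of the Basel sum make up a quarter of it, leaving three quarters of
  pi^2/6.\<close>

lemma sum_inverse_odd_squares: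
  "(\<lambda>N. \<Sum>j=1..N. 1 / (2 * real j - 1)\<^sup>2) \<longlonglongrightarrow> pi\<^sup>2 / 8"
proof -
  define S where "S n = (\<Sum>k=1..n. 1 / (real k)\<^sup>2)" for n
  have S: "S \<longlonglongrightarrow> pi\<^sup>2 / 6"
    using inverse_squares_sums unfolding sums_def S_def[abs_def]
    by (simp add: sum.atLeast1_atMost_eq add.commute lessThan_atLeast0)
  have "S (2 * N) = (\<Sum>j=1..N. 1 / (2 * real j - 1)\<^sup>2) + S N / 4" for N
  proof (induction N)
    case (Suc N)
    have "(real (2*N+2))\<^sup>2 = 4 * (real (Suc N))\<^sup>2"
      by (simp add: power2_eq_square algebra_simps)
    then have "1 / (real (2*N+2))\<^sup>2 = 1 / (real (Suc N))\<^sup>2 / 4"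
      by simp
    moreover have "S (2 * Suc N) = S (2 * N) + 1 / (2 * real (Suc N) - 1)\<^sup>2 + 1 / (real (2*N+2))\<^sup>2"
      by (simp add: S_def)
    ultimately show ?case using Suc by (simp add: S_def add_divide_distrib)
  qed (simp add: S_def)
  then have "(\<lambda>N. \<Sum>j=1..N. 1 / (2 * real j - 1)\<^sup>2) = (\<lambda>N. S (2 * N) - S N / 4)"
    by (auto simp: fun_eq_iff)
  moreover have "(\<lambda>N. S (2 * N)) \<longlonglongrightarrow> pi\<^sup>2 / 6"
    using S by (rule filterlim_compose) (rule mult_nat_left_at_top, simp)
  then have "(\<lambda>N. S (2 * N) - S N / 4) \<longlonglongrightarrow> pi\<^sup>2 / 6 - pi\<^sup>2 / 6 / 4"
    by (intro tendsto_intros S) auto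
  ultimately show ?thesis by simp
qed

text \<open>From cos(pi s) = sin(2 pi s) / (2 sin(pi s)): in the sine product for
  \<open>2 * s\<close> the factors of even index form the product for \<open>s\<close> and
  cancel.\<close>

lemma cos_product_formula:
  assumes "0 < s" "s < 1/2"
  shows "(\<lambda>N. \<Prod>j=1..N. 1 - 4 * s\<^sup>2 / (2 * real j - 1)\<^sup>2) \<longlonglongrightarrow> cos (pi * s)"
proof -
  define P where "P x n = (\<Prod>k=1..n. 1 - x\<^sup>2 / (real k)\<^sup>2)" for x :: real and n
  have P: "P x \<longlonglongrightarrow> sin (pi * x) / (pi * x)" if "x \<noteq> 0" for x
    using sin_product_formula_real'[OF that] by (simp add: P_def[abs_def])
  have "s\<^sup>2 < 1" using assms power_strict_mono[of s 1 2] by simp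
  have nz: "P s N \<noteq> 0" for N
  proof -
    have "1 - s\<^sup>2 / (real k)\<^sup>2 > 0" if "1 \<le> k" for k
    proof -
      have "1 \<le> (real k)\<^sup>2" using that by simp
      then show ?thesis using \<open>s\<^sup>2 < 1\<close> by (simp add: divide_less_eq)
    qed
    then have "0 < P s N" unfolding P_def by (intro prod_pos) auto
    then show ?thesis by simp
  qed
  have split: "P (2 * s) (2 * N) = (\<Prod>j=1..N. 1 - 4 * s\<^sup>2 / (2 * real j - 1)\<^sup>2) * P s N" for N
  proof (induction N)
    case (Suc N)
    have "P (2 * s) (2 * Suc N) = P (2 * s) (2 * N) * (1 - (2 * s)\<^sup>2 / (real (2*N+1))\<^sup>2)
        * (1 - (2 * s)\<^sup>2 / (real (2*N+2))\<^sup>2)"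
      by (simp add: P_def)
    also have "real (2*N+2) = 2 * real (Suc N)" by simp
    also have "(2 * s)\<^sup>2 / (2 * real (Suc N))\<^sup>2 = s\<^sup>2 / (real (Suc N))\<^sup>2"
      unfolding power_mult_distrib by simp
    also have "(2 * s)\<^sup>2 / (real (2*N+1))\<^sup>2 = 4 * s\<^sup>2 / (2 * real (Suc N) - 1)\<^sup>2"
      by (simp add: power2_eq_square)
    finally show ?case unfolding Suc by (simp add: P_def)
  qed (simp add: P_def)
  have "(\<lambda>N. P (2 * s) (2 * N)) \<longlonglongrightarrow> sin (pi * (2 * s)) / (pi * (2 * s))"
    using assms by (intro filterlim_compose[OF P mult_nat_left_at_top]) auto
  then have "(\<lambda>N. P (2 * s) (2 * N) / P s N) \<longlonglongrightarrow>
      (sin (pi * (2 * s)) / (pi * (2 * s))) / (sin (pi * s) / (pi * s))"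
    using assms sin_pi_pos[of s] by (intro tendsto_divide P) auto
  moreover have "(sin (pi * (2 * s)) / (pi * (2 * s))) / (sin (pi * s) / (pi * s)) = cos (pi * s)"
    using assms sin_pi_pos[of s] sin_double[of "pi * s"] by (simp add: field_simps)
  ultimately show ?thesis unfolding split using nz by simp
qed

lemma ln_one_minus_upper:
  fixes x :: real
  assumes "0 \<le> x" "x < 1"
  shows "ln (1 - x) \<le> - x - x^2/2 - x^3/3" "ln (1 - x) \<le> - x - x^2/2" "ln (1 - x) \<le> - x"
proof -
  define g where "g x = ln (1 - x) + x + x^2/2 + x^3/3" for x :: real
  have "g x \<le> g 0"
  proof (rule DERIV_nonpos_imp_nonincreasing[OF assms(1)])
    fix t assume t: "0 \<le> t" "t \<le> x"
    have "(g has_real_derivative (- 1 / (1 - t) + 1 + t + t^2)) (at t)"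
      unfolding g_def using t assms by (auto intro!: derivative_eq_intros simp: power2_eq_square)
    moreover have "- 1 / (1 - t) + 1 + t + t^2 = - (t^3 / (1 - t))"
      using t assms by (simp add: field_simps power2_eq_square power3_eq_cube)
    ultimately show "\<exists>y. (g has_real_derivative y) (at t) \<and> y \<le> 0"
      using t assms by force
  qed
  then show "ln (1 - x) \<le> - x - x^2/2 - x^3/3" by (simp add: g_def)
  moreover have "0 \<le> x^3/3" "0 \<le> x^2/2" using assms by auto
  ultimately show "ln (1 - x) \<le> - x - x^2/2" "ln (1 - x) \<le> - x" by linarith+
qed

text \<open>Raising the quadratic coefficient from 1/2 to 13/25 absorbs the rest of the series; the
  derivative of the difference changes sign exactly at 1/26.\<close>

lemma ln_one_minus_lower:
  fixes x :: real
  assumes "0 \<le> x" "x \<le> 1/26"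
  shows "- x - 13/25 * x^2 \<le> ln (1 - x)"
proof -
  define g where "g x = ln (1 - x) + x + 13/25 * x^2" for x :: real
  have "g 0 \<le> g x"
  proof (rule DERIV_nonneg_imp_nondecreasing[OF assms(1)])
    fix t assume t: "0 \<le> t" "t \<le> x"
    have "(g has_real_derivative (- 1 / (1 - t) + 1 + 26/25 * t)) (at t)"
      unfolding g_def using t assms by (auto intro!: derivative_eq_intros)
    moreover have "- 1 / (1 - t) + 1 + 26/25 * t = t * (1/25 - 26/25 * t) / (1 - t)"
      using t assms by (simp add: field_simps)
    moreover have "0 \<le> t * (1/25 - 26/25 * t) / (1 - t)"
      using t assms by (intro divide_nonneg_nonneg mult_nonneg_nonneg) auto
    ultimately show "\<exists>y. (g has_real_derivative y) (at t) \<and> 0 \<le> y"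
      by force
  qed
  then show ?thesis by (simp add: g_def)
qed

text \<open>The factor of index 1, singular at \<open>s = 1/2\<close>, is kept exactly. The linear
  terms of the others sum to a multiple of \<open>pi\<^sup>2/8 - 1\<close>; of the higher terms, all
  negative, the quadratic ones are kept for indices 2 to 7 and the cubic ones for 2 and 3.\<close>

lemma ln_cos_upper:
  assumes s: "0 < s" "s < 1/2"
  shows "ln (cos (pi * s)) \<le> ln (1 - 4 * s\<^sup>2) - 4 * s\<^sup>2 * (pi\<^sup>2/8 - 1)
    - 8 * s^4 * (1/3^4 + 1/5^4 + 1/7^4 + 1/9^4 + 1/11^4 + 1/13^4) - 64/3 * s^6 * (1/3^6 + 1/5^6)"
    (is "_ \<le> _ - _ - ?Q - ?R")
proof -
  define x where "x j = 4 * s\<^sup>2 / (2 * real j - 1)\<^sup>2" for j :: nat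
  define O2 where "O2 N = (\<Sum>j=1..N. 1 / (2 * real j - 1)\<^sup>2)" for N :: nat
  have "s\<^sup>2 < (1/2)\<^sup>2" using s by (intro power_strict_mono) auto
  then have s2: "4 * s\<^sup>2 < 1" by (simp add: power2_eq_square)
  have x: "0 \<le> x j" "x j < 1" if "1 \<le> j" for j
  proof -
    have "1 \<le> (2 * real j - 1)\<^sup>2" using that by simp
    then show "0 \<le> x j" "x j < 1" using s2 by (auto simp: x_def divide_less_eq)
  qed
  have bound: "(\<Sum>j=1..N. ln (1 - x j)) \<le> ln (1 - 4 * s\<^sup>2) - 4 * s\<^sup>2 * (O2 N - 1) - ?Q - ?R"
    if "7 \<le> N" for N
    using that
  proof (induction N rule: dec_induct)
    case base
    have "x 1 = 4 * s\<^sup>2" by (simp add: x_def)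
    have "(\<Sum>j=1..7. ln (1 - x j)) = ln (1 - x 1) + ln (1 - x 2) + ln (1 - x 3) + ln (1 - x 4)
        + ln (1 - x 5) + ln (1 - x 6) + ln (1 - x 7)"
      by (simp add: eval_nat_numeral)
    also have "\<dots> \<le> ln (1 - x 1) + (- x 2 - (x 2)^2/2 - (x 2)^3/3) + (- x 3 - (x 3)^2/2 - (x 3)^3/3)
        + (- x 4 - (x 4)^2/2) + (- x 5 - (x 5)^2/2) + (- x 6 - (x 6)^2/2) + (- x 7 - (x 7)^2/2)"
      by (intro add_mono order.refl ln_one_minus_upper x) auto
    also have "\<dots> = ln (1 - 4 * s\<^sup>2) - 4 * s\<^sup>2 * (O2 7 - 1) - ?Q - ?R"
      unfolding x_def O2_def
      by (simp add: eval_nat_numeral)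
    finally show ?case .
  next
    case (step N)
    have "(\<Sum>j=1..Suc N. ln (1 - x j)) \<le> ln (1 - 4 * s\<^sup>2) - 4 * s\<^sup>2 * (O2 N - 1) - ?Q - ?R - x (Suc N)"
      using step ln_one_minus_upper(3)[of "x (Suc N)"] x[of "Suc N"] by simp
    also have "\<dots> = ln (1 - 4 * s\<^sup>2) - 4 * s\<^sup>2 * (O2 (Suc N) - 1) - ?Q - ?R"
      by (simp add: O2_def x_def algebra_simps)
    finally show ?case .
  qed
  have cpos: "0 < cos (pi * s)" using s by (intro cos_gt_zero) (auto simp: field_simps)
  have "(\<lambda>N. \<Prod>j=1..N. 1 - x j) \<longlonglongrightarrow> cos (pi * s)"
    unfolding x_def by (rule cos_product_formula[OF s])
  then have "(\<lambda>N. ln (\<Prod>j=1..N. 1 - x j)) \<longlonglongrightarrow> ln (cos (pi * s))"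
    using cpos by (intro tendsto_ln) auto
  moreover have "ln (\<Prod>j=1..N. 1 - x j) = (\<Sum>j=1..N. ln (1 - x j))" for N
    by (subst ln_prod) (use x(2) in force)+
  ultimately have "(\<lambda>N. \<Sum>j=1..N. ln (1 - x j)) \<longlonglongrightarrow> ln (cos (pi * s))" by simp
  moreover have "(\<lambda>N. ln (1 - 4 * s\<^sup>2) - 4 * s\<^sup>2 * (O2 N - 1) - ?Q - ?R) \<longlonglongrightarrow>
      ln (1 - 4 * s\<^sup>2) - 4 * s\<^sup>2 * (pi\<^sup>2/8 - 1) - ?Q - ?R"
    unfolding O2_def by (intro tendsto_intros sum_inverse_odd_squares)
  ultimately show ?thesis
    by (rule LIMSEQ_le) (use bound in auto)
qed

text \<open>For odd m at least 7, 1/m^4 is at most 1/(49 m^2), so the tail of the quadratic terms is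
  again controlled by the sum of inverse odd squares. The range of \<open>s\<close> puts all
  arguments after the first below 1/26.\<close>

lemma ln_cos_lower:
  assumes s: "0 < s" "s \<le> 29/100"
  shows "ln (1 - 4 * s\<^sup>2) - 4 * s\<^sup>2 * (pi\<^sup>2/8 - 1)
    - 13/25 * (16 * s^4) * (1/3^4 + 1/5^4 + (pi\<^sup>2/8 - 1 - 1/9 - 1/25) / 49) \<le> ln (cos (pi * s))"
proof -
  define x where "x j = 4 * s\<^sup>2 / (2 * real j - 1)\<^sup>2" for j :: nat
  define O2 where "O2 N = (\<Sum>j=1..N. 1 / (2 * real j - 1)\<^sup>2)" for N :: nat
  \<comment> \<open>The bound as a function of the sum of inverse odd squares: partial sums in the
    induction, \<open>pi\<^sup>2/8\<close> in the limit.\<close>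
  define F where "F t = ln (1 - 4 * s\<^sup>2) - 4 * s\<^sup>2 * (t - 1)
    - 13/25 * (16 * s^4) * (1/3^4 + 1/5^4 + (t - 1 - 1/9 - 1/25) / 49)" for t :: real
  have s2': "s\<^sup>2 \<le> (29/100)\<^sup>2" using s by (intro power_mono) auto
  then have s2: "4 * s\<^sup>2 < 1" "4 * s\<^sup>2 / 9 \<le> 1/26" by (auto simp: power2_eq_square)
  have x: "0 \<le> x j" "x j < 1" if "1 \<le> j" for j
  proof -
    have "1 \<le> (2 * real j - 1)\<^sup>2" using that by simp
    then show "0 \<le> x j" "x j < 1" using s2 by (auto simp: x_def divide_less_eq)
  qed
  have x2: "x j \<le> 1/26" if "2 \<le> j" for j
  proof -
    have "(3::real)^2 \<le> (2 * real j - 1)\<^sup>2" using that by (intro power_mono) auto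
    then have "x j \<le> 4 * s\<^sup>2 / 9" unfolding x_def by (intro divide_left_mono) auto
    then show ?thesis using s2 by simp
  qed
  have bound: "F (O2 N) \<le> (\<Sum>j=1..N. ln (1 - x j))" if "3 \<le> N" for N
    using that
  proof (induction N rule: dec_induct)
    case base
    have "F (O2 3) = ln (1 - x 1) + (- x 2 - 13/25 * (x 2)^2) + (- x 3 - 13/25 * (x 3)^2)"
      unfolding x_def O2_def F_def
      by (simp add: eval_nat_numeral)
    also have "\<dots> \<le> ln (1 - x 1) + ln (1 - x 2) + ln (1 - x 3)"
      by (intro add_mono order.refl ln_one_minus_lower x x2) auto
    also have "\<dots> = (\<Sum>j=1..3. ln (1 - x j))"
      by (simp add: eval_nat_numeral)
    finally show ?case .
  next
    case (step N)
    define d where "d = (2 * real (Suc N) - 1)\<^sup>2"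
    have "(7::real)^2 \<le> (2 * real (Suc N) - 1)\<^sup>2" using step by (intro power_mono) auto
    then have d: "49 \<le> d" by (simp add: d_def)
    have O2: "O2 (Suc N) = O2 N + 1 / d" "x (Suc N) = 4 * s\<^sup>2 / d"
      by (auto simp: O2_def d_def x_def)
    have "(x (Suc N))\<^sup>2 = 16 * s^4 * (1 / d) * (1 / d)"
      by (simp add: O2 power2_eq_square power4_eq_xxxx)
    also have "\<dots> \<le> 16 * s^4 * (1 / d) * (1 / 49)"
      using d by (intro mult_left_mono) (auto simp: field_simps)
    finally have "13/25 * (x (Suc N))\<^sup>2 \<le> 13/25 * (16 * s^4) * (1 / d) / 49" by simp
    moreover have "F (O2 (Suc N)) = F (O2 N) - x (Suc N) - 13/25 * (16 * s^4) * (1 / d) / 49"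
      unfolding O2 F_def by (simp add: field_simps)
    moreover have "- x (Suc N) - 13/25 * (x (Suc N))^2 \<le> ln (1 - x (Suc N))"
      using step by (intro ln_one_minus_lower x x2) auto
    ultimately have "F (O2 (Suc N)) \<le> (\<Sum>j=1..N. ln (1 - x j)) + ln (1 - x (Suc N))"
      using step.IH by linarith
    then show ?case by simp
  qed
  have cpos: "0 < cos (pi * s)" using s by (intro cos_gt_zero) (auto simp: field_simps)
  have "(\<lambda>N. \<Prod>j=1..N. 1 - x j) \<longlonglongrightarrow> cos (pi * s)"
    unfolding x_def by (rule cos_product_formula) (use s in auto)
  then have "(\<lambda>N. ln (\<Prod>j=1..N. 1 - x j)) \<longlonglongrightarrow> ln (cos (pi * s))"
    using cpos by (intro tendsto_ln) auto
  moreover have "ln (\<Prod>j=1..N. 1 - x j) = (\<Sum>j=1..N. ln (1 - x j))" for N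
    by (subst ln_prod) (use x(2) in force)+
  ultimately have lim: "(\<lambda>N. \<Sum>j=1..N. ln (1 - x j)) \<longlonglongrightarrow> ln (cos (pi * s))" by simp
  have "(\<lambda>N. F (O2 N)) \<longlonglongrightarrow> F (pi\<^sup>2/8)"
    unfolding O2_def F_def by (intro tendsto_intros sum_inverse_odd_squares) auto
  then have "F (pi\<^sup>2/8) \<le> ln (cos (pi * s))"
    using lim by (rule LIMSEQ_le) (use bound in auto)
  then show ?thesis by (simp only: F_def)
qed

lemma log_sin_half_plus: "log_sin (1/2 + s) = ln (cos (pi * s))"
  unfolding log_sin_def by (simp add: distrib_left sin_add)

text \<open>Integrating a bound \<open>ln (1 - 4 s^2) - a s^2 - b s^4 - c s^6\<close> for \<open>ln (cos (pi s))\<close>.\<close>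

definition cos_bound_int :: "real \<Rightarrow> real \<Rightarrow> real \<Rightarrow> real \<Rightarrow> real" where
  "cos_bound_int a b c s = ((1 + 2 * s) * ln (1 + 2 * s) - (1 - 2 * s) * ln (1 - 2 * s)) / 2 - 2 * s
     - a * s^3 / 3 - b * s^5 / 5 - c * s^7 / 7"

lemma DERIV_cos_bound_int:
  assumes "0 \<le> s" "s < 1/2"
  shows "(cos_bound_int a b c has_real_derivative
    (ln (1 - 4 * s\<^sup>2) - a * s^2 - b * s^4 - c * s^6)) (at s)"
proof -
  have "1 - 4 * s\<^sup>2 = (1 + 2 * s) * (1 - 2 * s)" by (simp add: power2_eq_square algebra_simps)
  then have *: "ln (1 - 4 * s\<^sup>2) = ln (1 + 2 * s) + ln (1 - 2 * s)"
    using assms by (simp add: ln_mult)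
  have "(4 + 8 * s) / (1 + 2 * s) = 4" "(4 - 8 * s) / (1 - 2 * s) = 4"
    using assms by (auto simp: field_simps)
  then show ?thesis
    unfolding cos_bound_int_def[abs_def] * using assms
    by (auto intro!: derivative_eq_intros simp: add_divide_distrib)
qed

lemma cos_bound_int_0 [simp]: "cos_bound_int a b c 0 = 0"
  by (simp add: cos_bound_int_def)

lemma DERIV_log_sin_int_half_plus:
  assumes "0 \<le> s" "s < 1/2"
  shows "((\<lambda>s. log_sin_int (1/2 + s)) has_real_derivative ln (cos (pi * s))) (at s)"
proof -
  have "((\<lambda>s. log_sin_int (1/2 + s)) has_real_derivative log_sin (1/2 + s) * 1) (at s)"
    by (rule DERIV_chain2[OF DERIV_log_sin_int])
       (use assms in \<open>auto intro!: derivative_eq_intros\<close>)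
  then show ?thesis by (simp add: log_sin_half_plus)
qed

lemma log_sin_int_upper:
  assumes "0 \<le> v" "v < 1/2"
    and le: "\<And>s. 0 < s \<Longrightarrow> s < v \<Longrightarrow> ln (cos (pi * s)) \<le> ln (1 - 4 * s\<^sup>2) - a * s^2 - b * s^4 - c * s^6"
  shows "log_sin_int (1/2 + v) \<le> - ln 2 / 2 + cos_bound_int a b c v"
proof -
  let ?D = "\<lambda>s. cos_bound_int a b c s - log_sin_int (1/2 + s)"
  have D: "(?D has_real_derivative
      (ln (1 - 4 * s\<^sup>2) - a * s^2 - b * s^4 - c * s^6 - ln (cos (pi * s)))) (at s)"
    if "0 \<le> s" "s \<le> v" for s
    using that assms by (intro DERIV_diff DERIV_cos_bound_int DERIV_log_sin_int_half_plus) auto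
  have "?D 0 \<le> ?D v"
  proof (rule DERIV_nonneg_imp_increasing_open[OF assms(1)])
    show "continuous_on {0..v} ?D"
      by (intro continuous_at_imp_continuous_on ballI DERIV_isCont[OF D]) auto
    show "\<exists>y. (?D has_real_derivative y) (at s) \<and> 0 \<le> y" if "0 < s" "s < v" for s
      using D[of s] le[OF that] that by force
  qed
  then show ?thesis by (simp add: log_sin_int_half)
qed

lemma log_sin_int_lower:
  assumes "0 \<le> v" "v < 1/2"
    and le: "\<And>s. 0 < s \<Longrightarrow> s < v \<Longrightarrow> ln (1 - 4 * s\<^sup>2) - a * s^2 - b * s^4 - c * s^6 \<le> ln (cos (pi * s))"
  shows "- ln 2 / 2 + cos_bound_int a b c v \<le> log_sin_int (1/2 + v)"
proof -
  let ?D = "\<lambda>s. log_sin_int (1/2 + s) - cos_bound_int a b c s"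
  have D: "(?D has_real_derivative
      (ln (cos (pi * s)) - (ln (1 - 4 * s\<^sup>2) - a * s^2 - b * s^4 - c * s^6))) (at s)"
    if "0 \<le> s" "s \<le> v" for s
    using that assms by (intro DERIV_diff DERIV_cos_bound_int DERIV_log_sin_int_half_plus) auto
  have "?D 0 \<le> ?D v"
  proof (rule DERIV_nonneg_imp_increasing_open[OF assms(1)])
    show "continuous_on {0..v} ?D"
      by (intro continuous_at_imp_continuous_on ballI DERIV_isCont[OF D]) auto
    show "\<exists>y. (?D has_real_derivative y) (at s) \<and> 0 \<le> y" if "0 < s" "s < v" for s
      using D[of s] le[OF that] that by force
  qed
  then show ?thesis by (simp add: log_sin_int_half)
qed

section \<open>Decimal evaluation of the constant\<close>

lemma ln_2_bounds: "0.69314718 \<le> ln (2::real)" "ln (2::real) \<le> 0.69314719"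
  using ln_approx_bounds[of 2 10] by (auto simp: eval_nat_numeral)

lemma cos_bounds_deg_12:
  fixes x :: real
  assumes "0 < x"
  shows "cos x \<le> 1 - x^2/2 + x^4/24 - x^6/720 + x^8/40320 - x^10/3628800 + x^12/479001600"
    and "1 - x^2/2 + x^4/24 - x^6/720 + x^8/40320 - x^10/3628800 - x^12/479001600 \<le> cos x"
proof -
  obtain t where t: "cos x = (\<Sum>m<12. cos_coeff m * x ^ m) + cos (t + 1/2 * real 12 * pi) / fact 12 * x ^ 12"
    using Maclaurin_cos_expansion2[of x 12] assms by auto
  have "(\<Sum>m<12. cos_coeff m * x ^ m) = 1 - x^2/2 + x^4/24 - x^6/720 + x^8/40320 - x^10/3628800"
    by (simp add: lessThan_nat_numeral cos_coeff_def fact_numeral)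
  moreover have "\<bar>cos (t + 1/2 * real 12 * pi) / fact 12 * x ^ 12\<bar> \<le> x^12/479001600"
    using mult_right_mono[OF abs_cos_le_one, of "x^12" "t + 1/2 * real 12 * pi"]
    by (simp add: abs_mult fact_numeral)
  ultimately show "cos x \<le> 1 - x^2/2 + x^4/24 - x^6/720 + x^8/40320 - x^10/3628800 + x^12/479001600"
    and "1 - x^2/2 + x^4/24 - x^6/720 + x^8/40320 - x^10/3628800 - x^12/479001600 \<le> cos x"
    using t by linarith+
qed

text \<open>The point \<open>7912262 / 10^7\<close> lies just below the maximum point of \<open>mean_log_sin\<close>.\<close>

lemma cos_numeric_bounds:
  "0.60985866 \<le> cos (pi * 0.2912262)" "cos (pi * 0.2912262) \<le> 0.60985867"
proof -
  have v: "0.914914090 \<le> pi * 0.2912262" "pi * 0.2912262 \<le> (0.914914091::real)"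
    using pi_approx by auto
  have "cos (0.914914091::real) \<le> cos (pi * 0.2912262)"
    using v pi_approx by (intro cos_monotone_0_pi_le) auto
  moreover have "0.60985866 \<le> cos (0.914914091::real)"
    using cos_bounds_deg_12(2)[of "0.914914091"] by (simp add: power_divide)
  ultimately show "0.60985866 \<le> cos (pi * 0.2912262)" by linarith
  have "cos (pi * 0.2912262) \<le> cos (0.914914090::real)"
    using v pi_approx by (intro cos_monotone_0_pi_le) auto
  moreover have "cos (0.914914090::real) \<le> 0.60985867"
    using cos_bounds_deg_12(1)[of "0.914914090"] by (simp add: power_divide)
  ultimately show "cos (pi * 0.2912262) \<le> 0.60985867" by linarith
qed

lemma log_sin_numeric_bounds:
  "0.1986190 \<le> ln 2 + log_sin 0.7912262" "ln 2 + log_sin 0.7912262 \<le> 0.1986193"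
proof -
  let ?c = "cos (pi * 0.2912262)"
  have eq: "ln 2 + log_sin 0.7912262 = ln (2 * ?c)"
    using cos_numeric_bounds log_sin_half_plus[of "0.2912262"] by (simp add: ln_mult)
  have "0.1986190 \<le> ln (1.21971732::real)"
    using ln_approx_bounds[of "1.21971732" 5] by (auto simp: eval_nat_numeral)
  also have "\<dots> \<le> ln (2 * ?c)" using cos_numeric_bounds by (subst ln_le_cancel_iff) auto
  finally show "0.1986190 \<le> ln 2 + log_sin 0.7912262" by (simp only: eq)
  have "ln (2 * ?c) \<le> ln 1.21971734" using cos_numeric_bounds by (subst ln_le_cancel_iff) auto
  also have "\<dots> \<le> 0.1986193"
    using ln_approx_bounds[of "1.21971734" 5] by (auto simp: eval_nat_numeral)
  finally show "ln 2 + log_sin 0.7912262 \<le> 0.1986193" by (simp only: eq)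
qed

text \<open>Turns the logarithm of a number slightly below 1/2 into that of a number slightly above
  1, where few terms of the series suffice.\<close>

lemma ln_inverse_double: "0 < x \<Longrightarrow> ln (1 / (2 * x)) = - (ln 2 + ln (x::real))"
  by (simp add: ln_div ln_mult)

text \<open>The arguments are \<open>1 + 2 * s\<close> and \<open>1 - 2 * s\<close> from
  \<open>cos_bound_int\<close>, for \<open>s = 0.2912262\<close> and
  \<open>s = 0.29\<close>.\<close>

lemma ln_numeric_bounds:
  "ln (1.5824524::real) \<le> 0.45897580"
  "ln (0.4175476::real) \<ge> - 0.87335674"
  "ln (1.58::real) \<ge> 0.457424"
  "ln (0.42::real) \<le> - 0.867500"
proof -
  show "ln (1.5824524::real) \<le> 0.45897580"
    using ln_approx_bounds[of "1.5824524" 6] by (auto simp: eval_nat_numeral)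
  show "ln (1.58::real) \<ge> 0.457424"
    using ln_approx_bounds[of "1.58" 6] by (auto simp: eval_nat_numeral)
  show "ln (0.4175476::real) \<ge> - 0.87335674"
    using ln_approx_bounds[of "1 / 0.8350952" 5] ln_inverse_double[of "1 / 0.8350952"] ln_2_bounds
    by (auto simp: eval_nat_numeral)
  show "ln (0.42::real) \<le> - 0.867500"
    using ln_approx_bounds[of "1 / 0.84" 5] ln_inverse_double[of "1 / 0.84"] ln_2_bounds
    by (auto simp: eval_nat_numeral)
qed

lemma pi_squared_bounds: "9.8696044 \<le> pi\<^sup>2" "pi\<^sup>2 \<le> 9.8696045"
proof -
  have "(3.141592653588::real)\<^sup>2 \<le> pi\<^sup>2" "pi\<^sup>2 \<le> (3.1415926535899::real)\<^sup>2"
    using pi_approx by (auto intro!: power_mono)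
  then show "9.8696044 \<le> pi\<^sup>2" "pi\<^sup>2 \<le> 9.8696045" by (auto simp: power2_eq_square)
qed

lemma K_const_less: "K_const < 0.19862"
proof -
  \<comment> \<open>The point 0.7912262 is so close to the maximum point that
    \<open>K_const_upper\<close> applies with very little room; hence the many terms kept in
    \<open>ln_cos_upper\<close>.\<close>
  have "log_sin_int (1/2 + 0.2912262) \<le> - ln 2 / 2 + cos_bound_int (4 * (pi\<^sup>2/8 - 1))
      (8 * (1/3^4 + 1/5^4 + 1/7^4 + 1/9^4 + 1/11^4 + 1/13^4)) (64/3 * (1/3^6 + 1/5^6)) 0.2912262"
    (is "_ \<le> _ + cos_bound_int ?a ?b ?c _")
  proof (rule log_sin_int_upper)
    fix s :: real assume "0 < s" "s < 0.2912262"
    then have "s < 1/2" by simp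
    then show "ln (cos (pi * s)) \<le> ln (1 - 4 * s\<^sup>2) - ?a * s^2 - ?b * s^4 - ?c * s^6"
      using ln_cos_upper[OF \<open>0 < s\<close>] by (simp only: mult_ac)
  qed auto
  also have "\<dots> \<le> 0.7912262 * log_sin 0.7912262"
    using ln_numeric_bounds(1,2) pi_squared_bounds(1) ln_2_bounds log_sin_numeric_bounds(1)
    by (simp add: cos_bound_int_def power_divide) argo
  finally have "K_const \<le> ln 2 + log_sin 0.7912262"
    by (intro K_const_upper) auto
  then show ?thesis using log_sin_numeric_bounds(2) by simp
qed

text \<open>Any point bounds a maximum from below, and the mean is flat near its maximum, so the
  round value 0.79 and the coarser \<open>ln_cos_lower\<close> are accurate enough.\<close>

lemma K_const_greater: "0.1986 < K_const"
proof -
  define b where "b = 13/25 * 16 * (1/3^4 + 1/5^4 + (pi\<^sup>2/8 - 1 - 1/9 - 1/25) / 49)"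
  have "- ln 2 / 2 + cos_bound_int (4 * (pi\<^sup>2/8 - 1)) b 0 0.29 \<le> log_sin_int (1/2 + 0.29)"
    (is "_ + cos_bound_int ?a _ _ _ \<le> _")
  proof (rule log_sin_int_lower)
    fix s :: real assume "0 < s" "s < 0.29"
    then have "s \<le> 29/100" by simp
    then show "ln (1 - 4 * s\<^sup>2) - ?a * s^2 - b * s^4 - 0 * s^6 \<le> ln (cos (pi * s))"
      using ln_cos_lower[OF \<open>0 < s\<close>] by (simp only: b_def mult_ac mult_zero_left diff_zero)
  qed auto
  moreover have "log_sin_int 0.79 + 0.79 * ln 2 \<le> K_const * 0.79"
    by (rule log_sin_int_le_K) auto
  moreover have "0.79 * 0.1986 < 0.29 * ln 2 + cos_bound_int (4 * (pi\<^sup>2/8 - 1)) b 0 0.29"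
    using ln_numeric_bounds(3,4) pi_squared_bounds(2) ln_2_bounds
    by (simp add: cos_bound_int_def b_def power_divide) argo
  ultimately show ?thesis by simp
qed

section \<open>Small angles\<close>

text \<open>Up to 1/3 the derivative \<open>pi * cos (pi * x)\<close> is at least pi/2 > 1; beyond
  that the sine is at least 1/2.\<close>

lemma sin_pi_ge:
  assumes "0 \<le> t" "t \<le> 1/2"
  shows "t \<le> sin (pi * t)"
proof (cases "t \<le> 1/3")
  case True
  define g where "g t = sin (pi * t) - t" for t :: real
  have "g 0 \<le> g t"
  proof (rule DERIV_nonneg_imp_nondecreasing[OF assms(1)])
    fix x assume x: "0 \<le> x" "x \<le> t"
    have "cos (pi / 3) \<le> cos (pi * x)"
      using x True by (intro cos_monotone_0_pi_le) auto
    moreover have "1 < pi / 2" using pi_gt3 by simp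
    moreover have "pi * cos (pi / 3) \<le> pi * cos (pi * x)"
      using \<open>cos (pi / 3) \<le> cos (pi * x)\<close> by (intro mult_left_mono) auto
    moreover have "pi * cos (pi / 3) = pi / 2" by (simp add: cos_60)
    ultimately have "1 \<le> pi * cos (pi * x)" by linarith
    moreover have "(g has_real_derivative (pi * cos (pi * x) - 1)) (at x)"
      unfolding g_def by (auto intro!: derivative_eq_intros)
    ultimately show "\<exists>y. (g has_real_derivative y) (at x) \<and> 0 \<le> y" by force
  qed
  then show ?thesis by (simp add: g_def)
next
  case False
  have "sin (pi / 6) \<le> sin (pi * t)"
    using assms False by (intro sin_monotone_2pi_le) auto
  then show ?thesis using assms by (simp add: sin_30)
qed

text \<open>Compares the integrand with \<open>ln\<close>, whose integral is explicit; this measures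
  what the first step next to the singularity can cost.\<close>

lemma log_sin_int_ge:
  assumes "0 < h" "h \<le> 1/2"
  shows "h * ln h - h \<le> log_sin_int h"
proof -
  define D where "D t = log_sin_int t - (t * ln t - t)" for t
  have "D 0 \<le> D h"
  proof (rule DERIV_nonneg_imp_increasing_open[where f = D and a = 0 and b = h])
    show "continuous_on {0..h} D"
      unfolding D_def using assms
      by (intro continuous_on_diff[OF continuous_on_log_sin_int continuous_on_mult_ln_minus]) auto
    fix x assume x: "0 < x" "x < h"
    have "((\<lambda>t. t * ln t - t) has_real_derivative ln x) (at x)"
      using x by (auto intro!: derivative_eq_intros)
    then have "(D has_real_derivative (log_sin x - ln x)) (at x)"
      unfolding D_def using x assms by (intro DERIV_diff DERIV_log_sin_int) auto
    moreover have "ln x \<le> log_sin x"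
      unfolding log_sin_def using x assms sin_pi_ge[of x] by (intro ln_mono) auto
    ultimately show "\<exists>y. (D has_real_derivative y) (at x) \<and> 0 \<le> y" by force
  qed (use assms in auto)
  then show ?thesis by (simp add: D_def)
qed

text \<open>Adds the trapezoid bound over consecutive cells; the two end points carry only half
  weight there, which accounts for the last summand.\<close>

lemma sum_log_sin_le_int:
  assumes "0 < h" "0 < x" "x + real m * h < 1"
  shows "h * (\<Sum>i<Suc m. log_sin (x + real i * h))
    \<le> log_sin_int (x + real m * h) - log_sin_int x + h * (log_sin x + log_sin (x + real m * h)) / 2"
  using assms(3)
proof (induction m)
  case (Suc m)
  have pos: "0 < x + real m * h" using assms by (intro add_pos_nonneg) auto
  have "x + real m * h < 1" using Suc.prems assms by (simp add: algebra_simps)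
  note IH = Suc.IH[OF this]
  have "(x + real (Suc m) * h - (x + real m * h)) *
        (log_sin (x + real m * h) + log_sin (x + real (Suc m) * h)) / 2
      \<le> log_sin_int (x + real (Suc m) * h) - log_sin_int (x + real m * h)"
    using pos Suc.prems assms by (intro log_sin_int_trapezoid) (auto intro: mult_right_mono)
  moreover have "x + real (Suc m) * h - (x + real m * h) = h" by (simp add: algebra_simps)
  ultimately have "h * (log_sin (x + real m * h) + log_sin (x + real (Suc m) * h)) / 2
      \<le> log_sin_int (x + real (Suc m) * h) - log_sin_int (x + real m * h)" by simp
  with IH show ?case unfolding sum.lessThan_Suc[of _ "Suc m"] by (simp add: field_simps)
qed simp

text \<open>The trapezoid end terms are nonpositive, the integral up to the last point is bounded
  through \<open>K_const\<close>, and the missing piece before \<open>x\<close> costs at most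
  \<open>h - h * ln h\<close>. Dividing by \<open>h\<close> gives the error.\<close>

lemma sum_one_turn_le:
  assumes h: "0 < h" "h \<le> 1/2" and x: "0 < x" "x \<le> h" "x + real m * h < 1"
  shows "(\<Sum>i<Suc m. ln 2 + log_sin (x + real i * h)) \<le> K_const * real (Suc m) + (2 - ln h)"
proof -
  have pos: "0 < x + real m * h" using h x by (intro add_pos_nonneg) auto
  have "log_sin x \<le> 0" "log_sin (x + real m * h) \<le> 0"
    using h x pos by (auto intro!: log_sin_le_0)
  then have "h * (log_sin x + log_sin (x + real m * h)) / 2 \<le> 0"
    using h by (simp add: mult_nonneg_nonpos)
  with sum_log_sin_le_int[OF h(1) x(1,3)]
  have "h * (\<Sum>i<Suc m. log_sin (x + real i * h)) \<le> log_sin_int (x + real m * h) - log_sin_int x"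
    by linarith
  moreover have "log_sin_int (x + real m * h) \<le> (K_const - ln 2) * (x + real m * h)"
    using log_sin_int_le_K[of "x + real m * h"] x pos by (simp add: algebra_simps)
  moreover have "(K_const - ln 2) * (x + real m * h) \<le> (K_const - ln 2) * (real m * h)"
    using K_const_less ln_2_bounds x by (intro mult_left_mono_neg) auto
  moreover have "log_sin_int h \<le> log_sin_int x"
    using h x by (intro log_sin_int_antimono) auto
  moreover have "h * ln h - h \<le> log_sin_int h" using h by (intro log_sin_int_ge)
  ultimately have "h * (\<Sum>i<Suc m. log_sin (x + real i * h)) \<le> h * ((K_const - ln 2) * real m + 1 - ln h)"
    by (simp add: algebra_simps)
  then have "(\<Sum>i<Suc m. log_sin (x + real i * h)) \<le> (K_const - ln 2) * real m + 1 - ln h"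
    using h by simp
  moreover have "(\<Sum>i<Suc m. ln 2 + log_sin (x + real i * h))
      = real (Suc m) * ln 2 + (\<Sum>i<Suc m. log_sin (x + real i * h))"
    by (simp add: sum.distrib)
  moreover have "(K_const - ln 2) * real m + real (Suc m) * ln 2 = K_const * real m + ln 2"
    by (simp add: algebra_simps)
  moreover have "K_const * real (Suc m) = K_const * real m + K_const" by (simp add: algebra_simps)
  moreover have "0 \<le> K_const" "ln 2 \<le> (1::real)" using ln_2_bounds K_const_greater by auto
  ultimately show ?thesis by linarith
qed

lemma abs_sin_pi_minus_one: "\<bar>sin (pi * (x - 1))\<bar> = \<bar>sin (pi * x)\<bar>"
  by (simp add: right_diff_distrib sin_diff)

text \<open>The orbit \<open>x + i h\<close> is cut at the integers; each turn costs \<open>2 - ln h\<close>.\<close>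

lemma sum_turns_le:
  assumes h: "0 < h" "h \<le> 1/2" and x: "0 < x" "x \<le> h"
    and nz: "\<And>i. i < N \<Longrightarrow> sin (pi * (x + real i * h)) \<noteq> 0"
  shows "(\<Sum>i<N. ln \<bar>2 * sin (pi * (x + real i * h))\<bar>)
      \<le> K_const * real N + (1 + x + real N * h) * (2 - ln h)"
  using x nz
proof (induction N arbitrary: x rule: less_induct)
  case (less N)
  let ?f = "\<lambda>x. ln \<bar>2 * sin (pi * x)\<bar>"
  have f_eq: "?f y = ln 2 + log_sin y" if "0 < y" "y < 1" for y
    using sin_pi_pos[OF that] by (simp add: log_sin_def ln_mult)
  have "ln h \<le> ln 1" using h by (intro ln_mono) auto
  then have lnh: "0 \<le> 2 - ln h" by simp
  obtain p where "1 / h < real p" using reals_Archimedean2 by blast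
  then have "1 \<le> x + real p * h" using h less.prems by (simp add: field_simps)
  then have ex: "\<exists>i. 1 \<le> x + real i * h" by blast
  \<comment> \<open>The index at which the orbit first reaches or passes 1; the terms before it form
    one turn.\<close>
  define m where "m = (LEAST i. 1 \<le> x + real i * h)"
  have m: "1 \<le> x + real m * h" unfolding m_def by (rule LeastI_ex[OF ex])
  have small: "x + real i * h < 1" if "i < m" for i
    using not_less_Least[of i "\<lambda>i. 1 \<le> x + real i * h"] that by (force simp: m_def)
  have turn: "(\<Sum>i<q. ?f (x + real i * h)) \<le> K_const * real q + (2 - ln h)" if "q \<le> m" for q
  proof (cases q)
    case (Suc r)
    have "(\<Sum>i<q. ?f (x + real i * h)) = (\<Sum>i<q. ln 2 + log_sin (x + real i * h))"
      using small that h less.prems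
      by (intro sum.cong refl f_eq) (auto intro!: add_pos_nonneg)
    also have "\<dots> \<le> K_const * real q + (2 - ln h)"
      unfolding Suc using sum_one_turn_le[OF h less.prems(1,2)] small[of r] Suc that by auto
    finally show ?thesis .
  qed (use lnh in auto)
  show ?case
  proof (cases "N \<le> m")
    case True
    have "1 * (2 - ln h) \<le> (1 + x + real N * h) * (2 - ln h)"
      using lnh h less.prems by (intro mult_right_mono) auto
    then show ?thesis using turn[OF True] by (intro order.trans[OF turn[OF True]]) simp
  next
    case False
    then have "m < N" by simp
    have "m \<noteq> 0"
    proof
      assume "m = 0"
      then show False using m less.prems h by simp
    qed
    define x' where "x' = x + real m * h - 1"
    have "x + real (m - 1) * h < 1" using small[of "m - 1"] \<open>m \<noteq> 0\<close> by simp
    then have "x' < h" using \<open>m \<noteq> 0\<close> by (simp add: x'_def of_nat_diff algebra_simps)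
    have shift: "\<bar>sin (pi * (x' + real j * h))\<bar> = \<bar>sin (pi * (x + real (m + j) * h))\<bar>" for j
      using abs_sin_pi_minus_one[of "x + real (m + j) * h"] by (simp add: x'_def algebra_simps)
    \<comment> \<open>The orbit cannot hit 1, the sine being nonzero along it, so the next turn
      again starts strictly to the right of 0.\<close>
    have "x + real m * h \<noteq> 1" using less.prems(3)[OF \<open>m < N\<close>] by auto
    then have "0 < x'" using m by (simp add: x'_def)
    have "(\<Sum>j<N - m. ?f (x' + real j * h))
        \<le> K_const * real (N - m) + (1 + x' + real (N - m) * h) * (2 - ln h)"
    proof (rule less.IH)
      fix j assume "j < N - m"
      then have "sin (pi * (x + real (m + j) * h)) \<noteq> 0" by (intro less.prems(3)) simp
      then show "sin (pi * (x' + real j * h)) \<noteq> 0" using shift[of j] by fastforce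
    qed (use \<open>m < N\<close> \<open>m \<noteq> 0\<close> \<open>0 < x'\<close> \<open>x' < h\<close> in auto)
    moreover have "(\<Sum>i<N. ?f (x + real i * h))
        = (\<Sum>i<m. ?f (x + real i * h)) + (\<Sum>j<N - m. ?f (x' + real j * h))"
    proof -
      have "(\<Sum>i<N. ?f (x + real i * h)) = (\<Sum>i<m. ?f (x + real i * h)) + (\<Sum>i=m..<N. ?f (x + real i * h))"
        using \<open>m < N\<close> by (simp add: lessThan_atLeast0 sum.atLeastLessThan_concat)
      also have "(\<Sum>i=m..<N. ?f (x + real i * h)) = (\<Sum>j<N - m. ?f (x + real (m + j) * h))"
        using \<open>m < N\<close> sum.shift_bounds_nat_ivl[of "\<lambda>i. ?f (x + real i * h)" 0 m "N - m"]
        by (simp add: lessThan_atLeast0 add.commute)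
      finally show ?thesis by (simp only: abs_mult shift)
    qed
    \<comment> \<open>The bound on the number of turns drops by exactly 1, which pays for the turn
      just removed.\<close>
    moreover have "1 + x' + real (N - m) * h = x + real N * h"
      using \<open>m < N\<close> by (simp add: x'_def of_nat_diff algebra_simps)
    ultimately have "(\<Sum>i<N. ?f (x + real i * h))
        \<le> (K_const * real m + (2 - ln h)) + (K_const * real (N - m) + (x + real N * h) * (2 - ln h))"
      using turn[of m] by simp
    also have "\<dots> = K_const * real N + (1 + x + real N * h) * (2 - ln h)"
      using \<open>m < N\<close> by (simp add: of_nat_diff algebra_simps)
    finally show ?thesis .
  qed
qed

text \<open>If all \<open>k * t\<close> stay below 1/6, every factor is at most 1. Otherwise
  \<open>t\<close> is at least \<open>1 / (6 * n)\<close>, so each of the at most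
  \<open>W + 2\<close> turns costs at most \<open>2 + ln (6 * n)\<close>; a vanishing factor is set
  apart because \<open>ln\<close> needs nonzero arguments.\<close>

lemma prod_sin_small_angle:
  assumes t: "0 < t" "t \<le> 1/2" and n: "0 < n" "real n * t \<le> W"
  shows "(\<Prod>k=1..n. \<bar>2 * sin (pi * (real k * t))\<bar>)
    \<le> exp (K_const * real n + (W + 2) * (2 + ln (6 * real n)))"
proof -
  have "0 < W" using n t by (smt (verit) mult_pos_pos of_nat_0_less_iff)
  have ln6: "0 \<le> ln (6 * real n)" using n by simp
  consider "6 * real n * t < 1" | "\<exists>k\<in>{1..n}. sin (pi * (real k * t)) = 0"
    | "1 \<le> 6 * real n * t" "\<And>k. k \<in> {1..n} \<Longrightarrow> sin (pi * (real k * t)) \<noteq> 0"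
    by force
  then show ?thesis
  proof cases
    case 1
    have "(\<Prod>k=1..n. \<bar>2 * sin (pi * (real k * t))\<bar>) \<le> 1"
    proof (rule prod_le_1)
      fix k assume k: "k \<in> {1..n}"
      have "real k * t \<le> real n * t" using k t by (intro mult_right_mono) auto
      then have kt: "0 \<le> real k * t" "real k * t \<le> 1/6"
        using 1 t mult.assoc[of 6 "real n" t] by (simp, linarith)
      have "0 \<le> pi * (real k * t)" "0 \<le> pi / 2" "pi * (real k * t) \<le> pi * (1/6)"
        using kt t by (auto intro: mult_left_mono)
      then have "sin (pi * (real k * t)) \<le> sin (pi * (1/6))"
        by (intro sin_monotone_2pi_le) linarith+
      moreover have "0 \<le> sin (pi * (real k * t))"
        using kt by (intro sin_ge_zero) auto
      ultimately show "0 \<le> \<bar>2 * sin (pi * (real k * t))\<bar> \<and> \<bar>2 * sin (pi * (real k * t))\<bar> \<le> 1"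
        using sin_30 by simp
    qed
    also have "1 \<le> exp (K_const * real n + (W + 2) * (2 + ln (6 * real n)))"
      using K_const_greater \<open>0 < W\<close> ln6 by simp
    finally show ?thesis .
  next
    case 2
    then have "(\<Prod>k=1..n. \<bar>2 * sin (pi * (real k * t))\<bar>) = 0" by (intro prod_zero) auto
    then show ?thesis by (simp only: exp_ge_zero)
  next
    case 3
    have reidx: "(\<Sum>k=1..n. ln \<bar>2 * sin (pi * (real k * t))\<bar>)
        = (\<Sum>i<n. ln \<bar>2 * sin (pi * (t + real i * t))\<bar>)"
      by (simp add: sum.atLeast1_atMost_eq algebra_simps)
    have nz: "sin (pi * (t + real i * t)) \<noteq> 0" if "i < n" for i
      using 3(2)[of "Suc i"] that by (simp add: algebra_simps)
    have "- ln t \<le> ln (6 * real n)"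
      using ln_mono[of 1 "6 * real n * t"] 3(1) n t by (simp add: ln_mult)
    moreover have "0 \<le> - ln t" using ln_mono[of t 1] t by simp
    ultimately have "(1 + t + real n * t) * (2 - ln t) \<le> (W + 2) * (2 + ln (6 * real n))"
      using t n \<open>0 < W\<close> by (intro mult_mono; linarith)
    with sum_turns_le[of t t n] nz t
    have "(\<Sum>k=1..n. ln \<bar>2 * sin (pi * (real k * t))\<bar>)
        \<le> K_const * real n + (W + 2) * (2 + ln (6 * real n))"
      unfolding reidx by fastforce
    moreover have "(\<Prod>k=1..n. \<bar>2 * sin (pi * (real k * t))\<bar>)
        = exp (\<Sum>k=1..n. ln \<bar>2 * sin (pi * (real k * t))\<bar>)"
      using 3(2) by (auto simp: exp_sum intro!: prod.cong)
    ultimately show ?thesis by simp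
  qed
qed

section \<open>Large angles\<close>

text \<open>The Dirichlet kernel, by telescoping and without division.\<close>

lemma sum_cos_multiples:
  "2 * sin (a / 2) * (\<Sum>k=1..n. cos (real k * a)) = sin ((real n + 1/2) * a) - sin (a / 2)"
proof (induction n)
  case (Suc n)
  have "sin ((real (Suc n) + 1/2) * a) - sin ((real n + 1/2) * a) = 2 * sin (a / 2) * cos (real (Suc n) * a)"
    using sin_add[of "real (Suc n) * a" "a / 2"] sin_diff[of "real (Suc n) * a" "a / 2"]
    by (simp add: algebra_simps)
  with Suc show ?case by (simp add: algebra_simps)
qed simp

lemma sum_cos_ge_of_sin_ge:
  assumes "0 < d" "d \<le> \<bar>sin (a / 2)\<bar>"
  shows "- 1/2 - 1 / (2 * d) \<le> (\<Sum>k=1..n. cos (real k * a))"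
proof -
  have nz: "sin (a / 2) \<noteq> 0" using assms by auto
  have "(\<Sum>k=1..n. cos (real k * a)) = sin ((real n + 1/2) * a) / (2 * sin (a / 2)) - 1/2"
    using sum_cos_multiples[of a n] nz by (simp add: field_simps)
  moreover have "\<bar>sin ((real n + 1/2) * a) / (2 * sin (a / 2))\<bar> \<le> 1 / (2 * d)"
    unfolding abs_divide using assms
    by (intro frac_le) (auto simp: abs_mult)
  ultimately show ?thesis by linarith
qed

lemma cos_ge_quadratic: "1 - x\<^sup>2 / 2 \<le> cos (x::real)"
proof -
  have "(sin (x / 2))\<^sup>2 \<le> (x / 2)\<^sup>2"
    by (rule abs_le_square_iff[THEN iffD1, OF abs_sin_x_le_abs_x])
  then show ?thesis using cos_double_sin[of "x / 2"] by (simp add: power2_eq_square)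
qed

lemma sin_ge_cubic:
  fixes x :: real
  assumes "0 \<le> x"
  shows "x - x^3 / 6 \<le> sin x"
proof -
  define g where "g x = sin x - x + x^3 / 6" for x :: real
  have "g 0 \<le> g x"
  proof (rule DERIV_nonneg_imp_nondecreasing[OF assms])
    fix t assume "0 \<le> t" "t \<le> x"
    have "(g has_real_derivative (cos t - 1 + t\<^sup>2 / 2)) (at t)"
      unfolding g_def by (auto intro!: derivative_eq_intros)
    then show "\<exists>y. (g has_real_derivative y) (at t) \<and> 0 \<le> y"
      using cos_ge_quadratic[of t] by force
  qed
  then show ?thesis by (simp add: g_def)
qed

lemma sin_ge_linear:
  fixes x :: real
  assumes "0 \<le> x" "x\<^sup>2 \<le> 6 * (1 - c)"
  shows "c * x \<le> sin x"
proof -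
  have "x * (x\<^sup>2) \<le> x * (6 * (1 - c))" using assms by (intro mult_left_mono) auto
  then have "c * x \<le> x - x^3 / 6" by (simp add: power3_eq_cube power2_eq_square algebra_simps)
  then show ?thesis using sin_ge_cubic[OF assms(1)] by linarith
qed

text \<open>The true minimum of \<open>sin y / y\<close> is about \<open>-0.2172\<close>.\<close>

lemma sinc_lower:
  fixes y :: real
  assumes "0 < y"
  shows "- (11/50 * y) \<le> sin y"
proof -
  consider "y \<le> pi" | "5 \<le> y" | "pi < y" "y < 5" by linarith
  then show ?thesis
  proof cases
    case 1
    then have "0 \<le> sin y" using assms by (intro sin_ge_zero) auto
    then show ?thesis using assms by linarith
  next
    case 2
    then show ?thesis using sin_ge_minus_one[of y] by linarith
  next
    case 3
    \<comment> \<open>The sine is -1 at 3 pi/2. There \<open>sin y = - cos v\<close>, and a lower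
      bound for the half-angle sine gives the parabola \<open>1 - 2/5 * v\<^sup>2\<close> above
      \<open>cos v\<close>.\<close>
    define v where "v = 3/2 * pi - y"
    have pi_hi: "pi \<le> 3.15" and pi_lo: "157/50 \<le> pi" using pi_approx by auto
    have "\<bar>v\<bar> \<le> pi / 2" using 3 pi_lo unfolding v_def by linarith
    then have "\<bar>v\<bar> / 2 \<le> 79/100" using pi_hi by simp
    then have "(\<bar>v\<bar> / 2)\<^sup>2 \<le> (79/100)\<^sup>2" by (intro power_mono) auto
    then have "895/1000 * (\<bar>v\<bar> / 2) \<le> sin (\<bar>v\<bar> / 2)"
      by (intro sin_ge_linear) (auto simp: power2_eq_square)
    then have "(895/1000 * (\<bar>v\<bar> / 2))\<^sup>2 \<le> (sin (\<bar>v\<bar> / 2))\<^sup>2" by (intro power_mono) auto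
    then have "(895/2000)\<^sup>2 * v\<^sup>2 \<le> (sin (\<bar>v\<bar> / 2))\<^sup>2" by (simp add: power_mult_distrib power_divide)
    then have "2/5 * v\<^sup>2 \<le> 2 * (sin (\<bar>v\<bar> / 2))\<^sup>2"
      using zero_le_power2[of "sin (\<bar>v\<bar> / 2)"] zero_le_power2[of v] by (simp add: power_divide; argo)
    moreover have "cos v = 1 - 2 * (sin (\<bar>v\<bar> / 2))\<^sup>2"
      using cos_double_sin[of "\<bar>v\<bar> / 2"] by simp
    ultimately have "cos v \<le> 1 - 2/5 * v\<^sup>2" by linarith
    \<comment> \<open>The line lies above the parabola by completing the square at 11/40; 471/100 is
      3/2 times 157/50, a lower bound for 3 pi/2.\<close>
    moreover have "1 - 2/5 * v\<^sup>2 \<le> 11/50 * (471/100 - v)"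
      using zero_le_power2[of "v - 11/40"] by (simp add: power2_eq_square algebra_simps)
    moreover have "11/50 * (471/100 - v) \<le> 11/50 * y" using pi_lo by (simp add: v_def)
    moreover have "sin y = - cos v"
      using sin_3over2_pi cos_3over2_pi by (simp add: v_def cos_diff)
    ultimately show ?thesis by linarith
  qed
qed

text \<open>For \<open>a\<close> above 2/5 the Dirichlet kernel is bounded. For smaller
  \<open>a\<close>, \<open>2 * sin (a / 2)\<close> is at least \<open>993/1000 * a\<close>, so up to
  1/2 the sum is at least \<open>N\<close> times the lower bound -11/50 of \<open>sin y / y\<close>,
  worsened to -111/500.\<close>

lemma sum_cos_ge_aux:
  assumes a: "0 < a" "a \<le> pi"
  shows "- (111/500 * real n) - 9 \<le> (\<Sum>k=1..n. cos (real k * a))"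
proof -
  have s: "a / (2 * pi) \<le> sin (a / 2)"
    using sin_pi_ge[of "a / (2 * pi)"] a by (simp add: field_simps)
  have s0: "0 < sin (a / 2)" using a by (intro sin_gt_zero) auto
  show ?thesis
  proof (cases "a \<le> 2/5")
    case False
    then have "1/16 \<le> a / (2 * pi)" using pi_approx by (simp add: field_simps)
    then have "1/16 \<le> \<bar>sin (a / 2)\<bar>" using s by linarith
    then have "- 1/2 - 1 / (2 * (1/16)) \<le> (\<Sum>k=1..n. cos (real k * a))"
      by (intro sum_cos_ge_of_sin_ge) auto
    then show ?thesis by simp
  next
    case True
    have "(a / 2)\<^sup>2 \<le> (1/5)\<^sup>2" using True a by (intro power_mono) auto
    then have sl: "993/1000 * (a / 2) \<le> sin (a / 2)"
      using a by (intro sin_ge_linear) (auto simp: power2_eq_square)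
    define N where "N = real n + 1/2"
    have "0 < N * a" using a by (simp add: N_def)
    then have "11/50 * (N * a) \<le> (111/500 * 993/1000) * (N * a)" by simp
    also have "\<dots> = (111/500 * N) * (2 * (993/1000 * (a / 2)))" by simp
    also have "\<dots> \<le> (111/500 * N) * (2 * sin (a / 2))"
      using sl by (intro mult_left_mono) (auto simp: N_def)
    finally have "- (111/500 * N) * (2 * sin (a / 2)) \<le> sin (N * a)"
      using sinc_lower[OF \<open>0 < N * a\<close>] by simp
    also have "\<dots> = (1/2 + (\<Sum>k=1..n. cos (real k * a))) * (2 * sin (a / 2))"
      unfolding N_def using sum_cos_multiples[of a n] by (simp add: algebra_simps)
    finally have "- (111/500 * N) \<le> 1/2 + (\<Sum>k=1..n. cos (real k * a))"
      by (rule mult_right_le_imp_le) (use s0 in simp)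
    then have "- (111/500 * real n) - 1 \<le> (\<Sum>k=1..n. cos (real k * a))"
      unfolding N_def by argo
    then show ?thesis by simp
  qed
qed

text \<open>Periodicity and evenness of the cosine reduce \<open>a\<close> to [0, pi]; at 0 the sum
  is \<open>n\<close>.\<close>

lemma sum_cos_ge: "- (111/500 * real n) - 9 \<le> (\<Sum>k=1..n. cos (real k * a))"
proof -
  define j where "j = round (a / (2 * pi))"
  define b where "b = \<bar>a - 2 * pi * of_int j\<bar>"
  have "\<bar>a / (2 * pi) - of_int j\<bar> \<le> 1/2"
    unfolding j_def using of_int_round_abs_le[of "a / (2 * pi)"] by (simp only: abs_minus_commute)
  then have "\<bar>a / (2 * pi) - of_int j\<bar> * (2 * pi) \<le> 1/2 * (2 * pi)"
    by (intro mult_right_mono) auto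
  moreover have "(a / (2 * pi) - of_int j) * (2 * pi) = a - 2 * pi * of_int j"
    by (simp add: field_simps)
  then have "\<bar>a / (2 * pi) - of_int j\<bar> * (2 * pi) = b"
    unfolding b_def by (metis abs_mult abs_of_pos pi_gt_zero mult_pos_pos zero_less_numeral)
  ultimately have b: "0 \<le> b" "b \<le> pi" by (auto simp: b_def)
  have cos_eq: "cos (real k * a) = cos (real k * b)" for k
  proof -
    have "cos (real k * b) = cos \<bar>real k * (a - 2 * pi * of_int j)\<bar>"
      by (simp add: b_def abs_mult)
    also have "\<dots> = cos (real k * a - 2 * pi * of_int (int k * j))"
      by (simp add: algebra_simps)
    also have "\<dots> = cos (real k * a)" unfolding cos_diff cos_int_2pin sin_int_2pin by simp
    finally show ?thesis by simp
  qed
  show ?thesis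
  proof (cases "b = 0")
    case True
    then show ?thesis unfolding cos_eq by simp
  next
    case False
    then show ?thesis unfolding cos_eq using b by (intro sum_cos_ge_aux) auto
  qed
qed

text \<open>The Hermite-type majorant of \<open>ln\<close> on \<open>(0, 4]\<close> with \<open>u p' u - 1\<close> vanishing at
  \<open>9/20, 1, 2, 17/6, 7/2\<close>, found by numerical optimization.\<close>

definition ln_majorant :: "real \<Rightarrow> real" where
  "ln_majorant u = - 223/100 + 9341/2142 * u - 13519/4284 * u^2 + 602/459 * u^3
     - 587/2142 * u^4 + 8/357 * u^5"

text \<open>The quintic \<open>q u\<close> is \<open>2142 * u\<close> times the derivative of the
  difference \<open>g\<close>. Its sign pattern makes 9/20, 2 and 7/2 the local minima of
  \<open>g\<close>, and only there is \<open>g\<close> evaluated.\<close>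

lemma ln_le_majorant:
  assumes "0 < u" "u \<le> 4"
  shows "ln u \<le> ln_majorant u"
proof -
  define g where "g u = ln_majorant u - ln u" for u
  define q where "q u = (20 * u - 9) * (u - 1) * (u - 2) * (6 * u - 17) * (2 * u - 7)" for u :: real
  have D: "(g has_real_derivative q u / (2142 * u)) (at u)" if "0 < u" for u
  proof -
    have "(g has_real_derivative
        (9341/2142 - 13519/2142 * u + 602/153 * u^2 - 1174/1071 * u^3 + 40/357 * u^4 - 1 / u)) (at u)"
      unfolding g_def ln_majorant_def using that by (auto intro!: derivative_eq_intros)
    moreover have "q u = 240 * u^5 - 2348 * u^4 + 8428 * u^3 - 13519 * u^2 + 9341 * u - 2142"
      unfolding q_def by (simp add: algebra_simps eval_nat_numeral)
    then have "q u / (2142 * u)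
        = 9341/2142 - 13519/2142 * u + 602/153 * u^2 - 1174/1071 * u^3 + 40/357 * u^4 - 1 / u"
      using that by (simp add: field_simps eval_nat_numeral)
    ultimately show ?thesis by simp
  qed
  have dec: "g b \<le> g a" if "0 < a" "a \<le> b" "\<And>u. a \<le> u \<Longrightarrow> u \<le> b \<Longrightarrow> q u \<le> 0" for a b
  proof (rule DERIV_nonpos_imp_nonincreasing[OF that(2)])
    fix x assume "a \<le> x" "x \<le> b"
    then show "\<exists>y. (g has_real_derivative y) (at x) \<and> y \<le> 0"
      using that by (intro exI[of _ "q x / (2142 * x)"] conjI D divide_nonpos_pos) auto
  qed
  have inc: "g a \<le> g b" if "0 < a" "a \<le> b" "\<And>u. a \<le> u \<Longrightarrow> u \<le> b \<Longrightarrow> 0 \<le> q u" for a b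
  proof (rule DERIV_nonneg_imp_nondecreasing[OF that(2)])
    fix x assume "a \<le> x" "x \<le> b"
    then show "\<exists>y. (g has_real_derivative y) (at x) \<and> 0 \<le> y"
      using that by (intro exI[of _ "q x / (2142 * x)"] conjI D divide_nonneg_pos) auto
  qed
  have "ln (9/20::real) \<le> - 79849/100000"
    using ln_approx_bounds[of "10/9" 5] ln_inverse_double[of "10/9"] ln_2_bounds
    by (auto simp: eval_nat_numeral)
  then have g1: "0 \<le> g (9/20)" by (simp add: g_def ln_majorant_def power_divide)
  have g2: "0 \<le> g 2" using ln_2_bounds by (simp add: g_def ln_majorant_def)
  have "ln (7/2::real) \<le> 12528/10000"
    using ln_approx_bounds[of "7/2" 7] by (auto simp: eval_nat_numeral)
  then have g3: "0 \<le> g (7/2)" by (simp add: g_def ln_majorant_def power_divide)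
  have q1: "x \<le> 9/20 \<Longrightarrow> q x \<le> 0" for x
    unfolding q_def by (rule mult_nonneg_nonpos, rule mult_nonpos_nonpos, rule mult_nonneg_nonpos, rule mult_nonpos_nonpos) auto
  have q2: "9/20 \<le> x \<Longrightarrow> x \<le> 1 \<Longrightarrow> 0 \<le> q x" for x
    unfolding q_def by (rule mult_nonpos_nonpos, rule mult_nonneg_nonpos, rule mult_nonpos_nonpos, rule mult_nonneg_nonpos) auto
  have q3: "1 \<le> x \<Longrightarrow> x \<le> 2 \<Longrightarrow> q x \<le> 0" for x
    unfolding q_def by (rule mult_nonneg_nonpos, rule mult_nonpos_nonpos, rule mult_nonneg_nonpos, rule mult_nonneg_nonneg) auto
  have q4: "2 \<le> x \<Longrightarrow> x \<le> 17/6 \<Longrightarrow> 0 \<le> q x" for x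
    unfolding q_def by (rule mult_nonpos_nonpos, rule mult_nonneg_nonpos, rule mult_nonneg_nonneg, rule mult_nonneg_nonneg) auto
  have q5: "17/6 \<le> x \<Longrightarrow> x \<le> 7/2 \<Longrightarrow> q x \<le> 0" for x
    unfolding q_def by (rule mult_nonneg_nonpos, rule mult_nonneg_nonneg, rule mult_nonneg_nonneg, rule mult_nonneg_nonneg) auto
  have q6: "7/2 \<le> x \<Longrightarrow> 0 \<le> q x" for x
    unfolding q_def by (rule mult_nonneg_nonneg, rule mult_nonneg_nonneg, rule mult_nonneg_nonneg, rule mult_nonneg_nonneg) auto
  consider "u \<le> 9/20" | "9/20 \<le> u" "u \<le> 1" | "1 \<le> u" "u \<le> 2" | "2 \<le> u" "u \<le> 17/6"
    | "17/6 \<le> u" "u \<le> 7/2" | "7/2 \<le> u" by linarith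
  then have "0 \<le> g u"
  proof cases
    case 1
    then have "g (9/20) \<le> g u" using assms q1 by (intro dec) auto
    with g1 show ?thesis by linarith
  next
    case 2
    then have "g (9/20) \<le> g u" using q2 by (intro inc) auto
    with g1 show ?thesis by linarith
  next
    case 3
    then have "g 2 \<le> g u" using q3 by (intro dec) auto
    with g2 show ?thesis by linarith
  next
    case 4
    then have "g 2 \<le> g u" using q4 by (intro inc) auto
    with g2 show ?thesis by linarith
  next
    case 5
    then have "g (7/2) \<le> g u" using q5 by (intro dec) auto
    with g3 show ?thesis by linarith
  next
    case 6
    then have "g (7/2) \<le> g u" using q6 by (intro inc) auto
    with g3 show ?thesis by linarith
  qed
  then show ?thesis by (simp add: g_def)
qed

text \<open>Applied with \<open>2 - 2 * cos x = (2 * sin (x / 2))\<^sup>2\<close>. The constant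
  term, about 0.1263, is below \<open>K_const\<close>, and all cosine coefficients are negative, so
  only lower bounds for cosine sums are needed.\<close>

lemma ln_majorant_cos:
  fixes x :: real
  shows "ln_majorant (2 - 2 * cos x) / 2 = 11593/91800 - 1651/2142 * cos x - 1159/4284 * cos (2 * x)
    - 410/3213 * cos (3 * x) - 107/2142 * cos (4 * x) - 8/357 * cos (5 * x)"
proof -
  define y where "y = cos x"
  have step: "cos ((m + 1) * x) = 2 * y * cos (m * x) - cos ((m - 1) * x)" for m :: real
    by (simp add: y_def distrib_right left_diff_distrib cos_add cos_diff)
  have c2: "cos (2 * x) = 2 * y^2 - 1"
    using cos_double_cos[of x] by (simp add: y_def)
  have "cos (3 * x) = 2 * y * cos (2 * x) - y" using step[of 2] by (simp add: y_def)
  also have "\<dots> = 4 * y^3 - 3 * y" unfolding c2 by (simp add: algebra_simps eval_nat_numeral)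
  finally have c3: "cos (3 * x) = 4 * y^3 - 3 * y" .
  have "cos (4 * x) = 2 * y * cos (3 * x) - cos (2 * x)" using step[of 3] by simp
  also have "\<dots> = 8 * y^4 - 8 * y^2 + 1" unfolding c2 c3 by (simp add: algebra_simps eval_nat_numeral)
  finally have c4: "cos (4 * x) = 8 * y^4 - 8 * y^2 + 1" .
  have "cos (5 * x) = 2 * y * cos (4 * x) - cos (3 * x)" using step[of 4] by simp
  also have "\<dots> = 16 * y^5 - 20 * y^3 + 5 * y" unfolding c3 c4 by (simp add: algebra_simps eval_nat_numeral)
  finally have c5: "cos (5 * x) = 16 * y^5 - 20 * y^3 + 5 * y" .
  have pow: "(2 - 2 * y)^2 = 4 - 8 * y + 4 * y^2" "(2 - 2 * y)^3 = 8 - 24 * y + 24 * y^2 - 8 * y^3"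
    "(2 - 2 * y)^4 = 16 - 64 * y + 96 * y^2 - 64 * y^3 + 16 * y^4"
    "(2 - 2 * y)^5 = 32 - 160 * y + 320 * y^2 - 320 * y^3 + 160 * y^4 - 32 * y^5"
    by (simp_all add: algebra_simps eval_nat_numeral)
  show ?thesis
    unfolding c2 c3 c4 c5 y_def[symmetric] ln_majorant_def pow by argo
qed

lemma abs_sin_pi_ge:
  assumes "of_int j + d \<le> t" "t \<le> of_int j + 1 - d" "0 < d"
  shows "d \<le> \<bar>sin (pi * t)\<bar>"
proof -
  define r where "r = t - of_int j"
  have r: "d \<le> r" "r \<le> 1 - d" using assms by (auto simp: r_def)
  have "pi * t = pi * r + pi * of_int j" by (simp add: r_def algebra_simps)
  then have "\<bar>sin (pi * t)\<bar> = \<bar>sin (pi * r)\<bar>"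
    by (simp add: sin_add abs_mult sin_npi_int cos_npi_int)
  moreover have "d \<le> sin (pi * r)"
  proof (cases "r \<le> 1/2")
    case True
    then show ?thesis using sin_pi_ge[of r] r assms by linarith
  next
    case False
    have "sin (pi * (1 - r)) = sin (pi - pi * r)" by (simp add: algebra_simps)
    also have "\<dots> = sin (pi * r)" by simp
    finally show ?thesis using sin_pi_ge[of "1 - r"] r assms False by linarith
  qed
  ultimately show ?thesis by simp
qed

text \<open>A cosine sum of order \<open>m\<close> loses at most about \<open>n / 2000\<close> when
  \<open>m * t\<close> has distance at least \<open>1000 / n\<close> from the integers, and at most
  about \<open>0.222 * n\<close> in any case. The total stays below \<open>0.1986 * n\<close> plus a
  constant.\<close>

lemma prod_sin_large_angle:
  assumes n: "10000 \<le> n" and t: "1000 / real n \<le> t" "t \<le> 1/2"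
  shows "(\<Prod>k=1..n. \<bar>2 * sin (pi * (real k * t))\<bar>) \<le> exp (K_const * real n + 20)"
proof (cases "\<exists>k\<in>{1..n}. sin (pi * (real k * t)) = 0")
  case True
  then have "(\<Prod>k=1..n. \<bar>2 * sin (pi * (real k * t))\<bar>) = 0" by (intro prod_zero) auto
  then show ?thesis by (simp only: exp_ge_zero)
next
  case False
  define S where "S m = (\<Sum>k=1..n. cos (real k * (2 * pi * (m * t))))" for m :: real
  have bad: "- (111/500 * real n) - 9 \<le> S m" for m
    unfolding S_def by (rule sum_cos_ge)
  define d where "d = 1000 / real n"
  have d: "0 < d" "d \<le> 1/10" "d \<le> t" using n t by (auto simp: d_def field_simps)
  have good: "- 1/2 - real n / 2000 \<le> S m" if "of_int j + d \<le> m * t" "m * t \<le> of_int j + 1 - d" for j m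
  proof -
    have "d \<le> \<bar>sin (2 * pi * (m * t) / 2)\<bar>"
      using abs_sin_pi_ge[OF that d(1)] by simp
    then have "- 1/2 - 1 / (2 * d) \<le> S m"
      unfolding S_def using d by (intro sum_cos_ge_of_sin_ge)
    then show ?thesis by (simp add: d_def)
  qed
  have ln_le: "ln \<bar>2 * sin (pi * (real k * t))\<bar> \<le> 11593/91800
      - 1651/2142 * cos (real k * (2 * pi * (1 * t))) - 1159/4284 * cos (real k * (2 * pi * (2 * t)))
      - 410/3213 * cos (real k * (2 * pi * (3 * t))) - 107/2142 * cos (real k * (2 * pi * (4 * t)))
      - 8/357 * cos (real k * (2 * pi * (5 * t)))" if "k \<in> {1..n}" for k
  proof -
    define x where "x = 2 * pi * (real k * t)"
    have nz: "sin (pi * (real k * t)) \<noteq> 0" using False that by auto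
    have u: "(2 * sin (pi * (real k * t)))\<^sup>2 = 2 - 2 * cos x"
      using cos_double_sin[of "pi * (real k * t)"] by (simp add: x_def power_mult_distrib mult.assoc)
    have "2 * ln \<bar>2 * sin (pi * (real k * t))\<bar> = ln (\<bar>2 * sin (pi * (real k * t))\<bar>\<^sup>2)"
      using nz by (subst ln_realpow) auto
    also have "\<dots> = ln (2 - 2 * cos x)" by (simp only: power2_abs u)
    also have "\<dots> \<le> ln_majorant (2 - 2 * cos x)"
    proof (rule ln_le_majorant)
      show "0 < 2 - 2 * cos x" unfolding u[symmetric] using nz by simp
    qed (use cos_ge_minus_one[of x] in linarith)
    finally have "ln \<bar>2 * sin (pi * (real k * t))\<bar> \<le> ln_majorant (2 - 2 * cos x) / 2" by simp
    moreover have "real k * (2 * pi * (m * t)) = m * x" for m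
      unfolding x_def by (simp only: mult_ac)
    then have "cos (real k * (2 * pi * (m * t))) = cos (m * x)" for m by (simp only:)
    ultimately show ?thesis by (simp only: ln_majorant_cos mult_1_left[of x])
  qed
  have "(\<Sum>k=1..n. ln \<bar>2 * sin (pi * (real k * t))\<bar>)
      \<le> (\<Sum>k=1..n. 11593/91800
      - 1651/2142 * cos (real k * (2 * pi * (1 * t))) - 1159/4284 * cos (real k * (2 * pi * (2 * t)))
      - 410/3213 * cos (real k * (2 * pi * (3 * t))) - 107/2142 * cos (real k * (2 * pi * (4 * t)))
      - 8/357 * cos (real k * (2 * pi * (5 * t))))"
    by (intro sum_mono ln_le)
  also have "\<dots> = 11593/91800 * real n - 1651/2142 * S 1 - 1159/4284 * S 2 - 410/3213 * S 3
      - 107/2142 * S 4 - 8/357 * S 5"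
    unfolding sum_subtractf sum_distrib_left[symmetric] S_def by simp
  also have "\<dots> \<le> 993/5000 * real n + 20"
  proof -
    \<comment> \<open>The ranges separate which multiples of \<open>t\<close> can be near an
      integer: 4 and 5, then 3, then 5, then 2 and 4. The last range, near 1/2, is the
      tightest.\<close>
    consider "t \<le> 29/100" | "29/100 \<le> t" "t \<le> 38/100" | "38/100 \<le> t" "t \<le> 45/100"
      | "45/100 \<le> t" by linarith
    then show ?thesis
    proof cases
      case 1
      have "- 1/2 - real n / 2000 \<le> S 1" "- 1/2 - real n / 2000 \<le> S 2"
        "- 1/2 - real n / 2000 \<le> S 3"
        by (rule good[of 0 1] good[of 0 2] good[of 0 3]; use d 1 in simp)+
      then show ?thesis using bad[of 4] bad[of 5] of_nat_0_le_iff[where 'a = real, of n] by argo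
    next
      case 2
      have "- 1/2 - real n / 2000 \<le> S 1" "- 1/2 - real n / 2000 \<le> S 2"
        "- 1/2 - real n / 2000 \<le> S 4" "- 1/2 - real n / 2000 \<le> S 5"
        by (rule good[of 0 1] good[of 0 2] good[of 1 4] good[of 1 5]; use d 2 in simp)+
      then show ?thesis using bad[of 3] of_nat_0_le_iff[where 'a = real, of n] by argo
    next
      case 3
      have "- 1/2 - real n / 2000 \<le> S 1" "- 1/2 - real n / 2000 \<le> S 2"
        "- 1/2 - real n / 2000 \<le> S 3" "- 1/2 - real n / 2000 \<le> S 4"
        by (rule good[of 0 1] good[of 0 2] good[of 1 3] good[of 1 4]; use d 3 in simp)+
      then show ?thesis using bad[of 5] of_nat_0_le_iff[where 'a = real, of n] by argo
    next
      case 4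
      have "- 1/2 - real n / 2000 \<le> S 1" "- 1/2 - real n / 2000 \<le> S 3"
        "- 1/2 - real n / 2000 \<le> S 5"
        by (rule good[of 0 1] good[of 1 3] good[of 2 5]; use d t 4 in simp)+
      then show ?thesis using bad[of 2] bad[of 4] of_nat_0_le_iff[where 'a = real, of n] by argo
    qed
  qed
  also have "993/5000 * real n \<le> K_const * real n"
    using K_const_greater by (intro mult_right_mono) auto
  finally have "(\<Sum>k=1..n. ln \<bar>2 * sin (pi * (real k * t))\<bar>) \<le> K_const * real n + 20" by simp
  moreover have "(\<Prod>k=1..n. \<bar>2 * sin (pi * (real k * t))\<bar>)
      = exp (\<Sum>k=1..n. ln \<bar>2 * sin (pi * (real k * t))\<bar>)"
    using False by (auto simp: exp_sum intro!: prod.cong)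
  ultimately show ?thesis by simp
qed

text \<open>The product depends only on the distance \<open>r\<close> from \<open>t\<close> to the
  nearest integer, and \<open>n * r = 1000\<close> separates the two regimes. The constants cover
  both 1002 times \<open>2 + ln (6 * n)\<close> and 20.\<close>

lemma prod_sin_upper_bound:
  assumes n: "10000 \<le> n"
  shows "(\<Prod>k=1..n. \<bar>2 * sin (pi * (real k * t))\<bar>)
    \<le> exp (K_const * real n + (2024 + 1002 * ln (6 * real n)))"
proof -
  define j where "j = round t"
  define r where "r = \<bar>t - of_int j\<bar>"
  have "r \<le> 1/2" unfolding r_def j_def using of_int_round_abs_le[of t] by (simp only: abs_minus_commute)
  have "\<bar>sin (pi * (real k * t))\<bar> = \<bar>sin (pi * (real k * r))\<bar>" for k
  proof -
    have "pi * (real k * t) = pi * (real k * (t - of_int j)) + pi * of_int (int k * j)"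
      by (simp add: algebra_simps)
    then have "\<bar>sin (pi * (real k * t))\<bar> = \<bar>sin (pi * (real k * (t - of_int j)))\<bar>"
      by (simp only: sin_add sin_npi_int cos_npi_int) (simp add: abs_mult)
    moreover have "t - of_int j = r \<or> t - of_int j = - r" by (auto simp: r_def)
    ultimately show ?thesis by (elim disjE) simp_all
  qed
  then have eq: "(\<Prod>k=1..n. \<bar>2 * sin (pi * (real k * t))\<bar>) = (\<Prod>k=1..n. \<bar>2 * sin (pi * (real k * r))\<bar>)"
    by (simp add: abs_mult)
  have ln6: "0 \<le> ln (6 * real n)" using n by simp
  consider "r = 0" | "0 < r" "real n * r \<le> 1000" | "1000 \<le> real n * r"
    unfolding r_def by linarith
  then show ?thesis
  proof cases
    case 1
    then have "(\<Prod>k=1..n. \<bar>2 * sin (pi * (real k * r))\<bar>) = 0"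
      using n by (intro prod_zero) (auto intro!: bexI[of _ 1])
    then show ?thesis unfolding eq by (simp only: exp_ge_zero)
  next
    case 2
    then show ?thesis
      unfolding eq using prod_sin_small_angle[of r n 1000] \<open>r \<le> 1/2\<close> n
      by (simp add: algebra_simps) (smt (verit) exp_le_cancel_iff)
  next
    case 3
    then have "1000 / real n \<le> r" using n by (simp add: field_simps)
    then have "(\<Prod>k=1..n. \<bar>2 * sin (pi * (real k * r))\<bar>) \<le> exp (K_const * real n + 20)"
      using prod_sin_large_angle[OF n] \<open>r \<le> 1/2\<close> by blast
    also have "\<dots> \<le> exp (K_const * real n + (2024 + 1002 * ln (6 * real n)))" using ln6 by simp
    finally show ?thesis unfolding eq .
  qed
qed

section \<open>Coefficients and values on the unit circle\<close>

definition power_prod :: "nat \<Rightarrow> nat \<Rightarrow> complex \<Rightarrow> complex" where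
  "power_prod s n z = (\<Prod>k=1..n. (1 - z ^ k) ^ s)"

lemma degree_prod_one_minus_monom:
  "degree (\<Prod>k=1..n. (1 - monom (1::int) k) ^ s) \<le> s * n * (n + 1) div 2"
proof -
  have "degree (\<Prod>k=1..n. (1 - monom (1::int) k) ^ s) \<le> (\<Sum>k=1..n. degree ((1 - monom (1::int) k) ^ s))"
    by (rule degree_prod_sum_le[unfolded o_def]) simp
  also have "\<dots> \<le> (\<Sum>k=1..n. s * k)"
  proof (rule sum_mono)
    fix k :: nat
    have "degree (1 - monom (1::int) k) \<le> k"
      by (intro degree_diff_le degree_monom_le) simp
    then have "s * degree (1 - monom (1::int) k) \<le> s * k" by simp
    then show "degree ((1 - monom (1::int) k) ^ s) \<le> s * k"
      using degree_power_le[of "1 - monom (1::int) k" s] by (simp only: mult.commute[of s])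
  qed
  also have "\<dots> = s * (n * (n + 1) div 2)"
    using gauss_sum_from_Suc_0[of n, where ?'a = nat] by (simp flip: sum_distrib_left)
  also have "2 dvd n * (n + 1)" by simp
  then have "s * (n * (n + 1) div 2) = s * n * (n + 1) div 2"
    by (simp only: div_mult_swap mult.assoc)
  finally show ?thesis .
qed

lemma map_poly_of_int_mult:
  "map_poly (of_int :: int \<Rightarrow> 'a::comm_ring_1) (p * q) = map_poly of_int p * map_poly of_int q"
  by (rule poly_eqI) (simp add: coeff_map_poly coeff_mult)

lemma map_poly_of_int_power:
  "map_poly (of_int :: int \<Rightarrow> 'a::comm_ring_1) (p ^ m) = map_poly of_int p ^ m"
  by (induction m) (auto simp: map_poly_of_int_mult map_poly_1')

lemma map_poly_of_int_prod:
  "map_poly (of_int :: int \<Rightarrow> 'a::comm_ring_1) (prod f A) = (\<Prod>x\<in>A. map_poly of_int (f x))"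
  by (induction A rule: infinite_finite_induct) (auto simp: map_poly_of_int_mult map_poly_1')

lemma power_prod_expansion:
  "power_prod s n z = (\<Sum>j\<le>s * n * (n + 1) div 2. of_int (t_coeff j s n) * z ^ j)"
proof -
  let ?Q = "\<Prod>k=1..n. (1 - monom (1::int) k) ^ s"
  have factor: "map_poly of_int (1 - monom (1::int) k) = 1 - monom (1::complex) k" for k
    by (rule poly_eqI) (auto simp: coeff_map_poly coeff_monom)
  have "poly (map_poly of_int ?Q) z = power_prod s n z"
    by (simp add: map_poly_of_int_prod map_poly_of_int_power factor power_prod_def poly_prod poly_monom)
  moreover have "degree (map_poly (of_int :: int \<Rightarrow> complex) ?Q) \<le> s * n * (n + 1) div 2"
    by (intro degree_le allI impI)
       (use degree_prod_one_minus_monom[where n = n and s = s] in \<open>simp add: coeff_map_poly coeff_eq_0\<close>)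
  then have "poly (map_poly of_int ?Q) z
      = (\<Sum>j\<le>s * n * (n + 1) div 2. coeff (map_poly of_int ?Q) j * z ^ j)"
    unfolding poly_altdef by (intro sum.mono_neutral_left) (auto simp: coeff_eq_0)
  ultimately show ?thesis by (simp add: t_coeff_def coeff_map_poly)
qed

lemma norm_one_minus_cis: "norm (1 - cis x) = \<bar>2 * sin (x / 2)\<bar>"
proof -
  have "(norm (1 - cis x))\<^sup>2 = (1 - cos x)\<^sup>2 + (sin x)\<^sup>2"
    by (simp add: cmod_power2)
  also have "\<dots> = 2 - 2 * cos x"
    using sin_cos_squared_add[of x] by (simp add: power2_eq_square algebra_simps)
  also have "\<dots> = (2 * sin (x / 2))\<^sup>2"
    using cos_double_sin[of "x / 2"] by (simp add: power_mult_distrib)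
  finally show ?thesis by (metis abs_norm_cancel power2_eq_iff_nonneg abs_ge_zero power2_abs norm_ge_zero)
qed

lemma norm_power_prod_cis:
  "norm (power_prod s n (cis (2 * pi * t))) = (\<Prod>k=1..n. \<bar>2 * sin (pi * (real k * t))\<bar>) ^ s"
proof -
  have "norm (1 - cis (2 * pi * t) ^ k) = \<bar>2 * sin (pi * (real k * t))\<bar>" for k
    unfolding Complex.DeMoivre norm_one_minus_cis by (simp add: mult_ac)
  then show ?thesis
    by (simp only: power_prod_def prod_norm[symmetric] norm_power prod_power_distrib[symmetric])
qed

text \<open>A geometric sum whose ratio satisfies \<open>z ^ R = 1\<close> and differs from 1,
  because \<open>d / R\<close> lies strictly between -1 and 1 and is not 0.\<close>

lemma sum_roots_of_unity_power:
  fixes d :: int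
  assumes "d \<noteq> 0" "\<bar>d\<bar> < int R"
  shows "(\<Sum>m<R. cis (2 * pi * (real m * of_int d / real R))) = 0"
proof -
  define x where "x = of_int d / real R"
  define z where "z = cis (2 * pi * x)"
  have R: "0 < R" using assms by linarith
  have "0 < \<bar>x\<bar>" using assms R by (simp add: x_def)
  moreover have "\<bar>x\<bar> < 1"
    using assms(2) R by (simp add: x_def abs_divide)
  ultimately have "0 < sin (pi * \<bar>x\<bar>)" by (rule sin_pi_pos)
  then have "sin (pi * x) \<noteq> 0" by (auto simp: abs_if split: if_splits)
  then have "norm (1 - z) \<noteq> 0" unfolding z_def norm_one_minus_cis by simp
  then have z1: "z \<noteq> 1" by auto
  have "z ^ R = cis (2 * pi * of_int d)"
    unfolding z_def Complex.DeMoivre using R by (simp add: x_def mult_ac)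
  then have zR: "z ^ R = 1" by (simp add: cis.ctr complex_eq_iff)
  have "(\<Sum>m<R. cis (2 * pi * (real m * of_int d / real R))) = (\<Sum>m<R. z ^ m)"
    unfolding z_def Complex.DeMoivre by (intro sum.cong refl) (simp add: x_def mult_ac)
  also have "\<dots> = 0" using sum_gp_strict[of z R] z1 zR by simp
  finally show ?thesis .
qed

text \<open>Each coefficient is an average of values at roots of unity of order exceeding the degree.\<close>

lemma norm_coeff_le_sup:
  fixes c :: "nat \<Rightarrow> complex"
  assumes j: "j \<le> D" and B: "\<And>t. norm (\<Sum>i\<le>D. c i * cis (2 * pi * t) ^ i) \<le> B"
  shows "norm (c j) \<le> B"
proof -
  define R where "R = Suc D"
  define f where "f t = (\<Sum>i\<le>D. c i * cis (2 * pi * t) ^ i)" for t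
  have fB: "norm (f t) \<le> B" for t unfolding f_def by (rule B)
  have term_eq: "cis (2 * pi * (real m / real R)) ^ i * cis (- (2 * pi * (real m / real R) * real j))
      = cis (2 * pi * (real m * of_int (int i - int j) / real R))" for m i
    unfolding Complex.DeMoivre cis_mult by (intro arg_cong[of _ _ cis]) (simp add: diff_divide_distrib algebra_simps)
  \<comment> \<open>Exchanging the sums isolates \<open>c j\<close>: the differences of indices are
    smaller than \<open>R\<close> in absolute value, so all other terms vanish.\<close>
  have "(\<Sum>m<R. f (real m / real R) * cis (- (2 * pi * (real m / real R) * real j)))
      = (\<Sum>m<R. \<Sum>i\<le>D. c i * cis (2 * pi * (real m * of_int (int i - int j) / real R)))"
    unfolding f_def sum_distrib_right term_eq[symmetric]
    by (intro sum.cong refl) (simp only: mult.assoc)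
  also have "\<dots> = (\<Sum>i\<le>D. c i * (\<Sum>m<R. cis (2 * pi * (real m * of_int (int i - int j) / real R))))"
    unfolding sum_distrib_left by (rule sum.swap)
  also have "\<dots> = (\<Sum>i\<le>D. if i = j then c j * of_nat R else 0)"
  proof (intro sum.cong refl)
    fix i assume i: "i \<in> {..D}"
    show "c i * (\<Sum>m<R. cis (2 * pi * (real m * of_int (int i - int j) / real R)))
        = (if i = j then c j * of_nat R else 0)"
    proof (cases "i = j")
      case False
      then show ?thesis
        using i j sum_roots_of_unity_power[of "int i - int j" R] by (simp add: R_def)
    qed simp
  qed
  also have "\<dots> = c j * of_nat R" using j by simp
  finally have "norm (c j * of_nat R)
      = norm (\<Sum>m<R. f (real m / real R) * cis (- (2 * pi * (real m / real R) * real j)))" by simp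
  also have "\<dots> \<le> (\<Sum>m<R. B)"
    using fB by (intro sum_norm_le) (simp add: norm_mult)
  finally have "norm (c j) * real R \<le> B * real R" by (simp add: norm_mult mult.commute)
  then show ?thesis by (simp add: R_def)
qed

section \<open>Two-sided bounds for the largest coefficient\<close>

lemma max_coeff_ge: "j \<le> s * n * (n + 1) div 2 \<Longrightarrow> \<bar>t_coeff j s n\<bar> \<le> max_coeff n s"
  unfolding max_coeff_def by (rule Max_ge) auto

lemma max_coeff_attained: "\<exists>j \<le> s * n * (n + 1) div 2. max_coeff n s = \<bar>t_coeff j s n\<bar>"
proof -
  have "max_coeff n s \<in> (\<lambda>j. \<bar>t_coeff j s n\<bar>) ` {0..s * n * (n + 1) div 2}"
    unfolding max_coeff_def by (rule Max_in) auto
  then show ?thesis by auto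
qed

lemma max_coeff_upper:
  assumes "10000 \<le> n"
  shows "real_of_int (max_coeff n s)
    \<le> exp (real s * K_const * real n + real s * (2024 + 1002 * ln (6 * real n)))"
proof -
  let ?E = "K_const * real n + (2024 + 1002 * ln (6 * real n))"
  obtain j where j: "j \<le> s * n * (n + 1) div 2" "max_coeff n s = \<bar>t_coeff j s n\<bar>"
    using max_coeff_attained by blast
  have "norm (of_int (t_coeff j s n) :: complex) \<le> exp ?E ^ s"
  proof (rule norm_coeff_le_sup[OF j(1)])
    fix t
    have "norm (power_prod s n (cis (2 * pi * t))) \<le> exp ?E ^ s"
      unfolding norm_power_prod_cis
      by (intro power_mono prod_sin_upper_bound assms prod_nonneg) auto
    then show "norm (\<Sum>i\<le>s * n * (n + 1) div 2. of_int (t_coeff i s n) * cis (2 * pi * t) ^ i) \<le> exp ?E ^ s"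
      unfolding power_prod_expansion .
  qed
  also have "exp ?E ^ s = exp (real s * K_const * real n + real s * (2024 + 1002 * ln (6 * real n)))"
    unfolding exp_of_nat_mult[symmetric] by (simp add: algebra_simps)
  finally show ?thesis unfolding j(2) by simp
qed

text \<open>The modulus at one point of the unit circle is at most the number of coefficients times
  the largest one. The constant \<open>c\<close> is \<open>sin (pi * w)\<close> at the maximum
  point, independent of \<open>n\<close> and \<open>s\<close>.\<close>

lemma max_coeff_lower:
  obtains c where "0 < c" "\<And>n s. n > 0 \<Longrightarrow>
    (exp (K_const * real n) * c) ^ s \<le> (real s + 1) * (real n)\<^sup>2 * real_of_int (max_coeff n s)"
proof -
  obtain w where w: "1/2 < w" "w < 9/10" "0 < sin (pi * w)"
    "\<And>n. n > 0 \<Longrightarrow> exp (K_const * real n) * sin (pi * w)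
        \<le> (\<Prod>k=1..n. 2 * sin (pi * (real k * (w / real n))))"
    by (rule prod_sin_lower_bound) blast
  have "(exp (K_const * real n) * sin (pi * w)) ^ s \<le> (real s + 1) * (real n)\<^sup>2 * real_of_int (max_coeff n s)"
    if n: "n > 0" for n s
  proof -
    define D where "D = s * n * (n + 1) div 2"
    define z where "z = cis (2 * pi * (w / real n))"
    have M0: "0 \<le> max_coeff n s" using max_coeff_ge[of 0 s n] by linarith
    have "exp (K_const * real n) * sin (pi * w) \<le> \<bar>\<Prod>k=1..n. 2 * sin (pi * (real k * (w / real n)))\<bar>"
      using w(4)[OF n] by linarith
    also have "\<dots> = (\<Prod>k=1..n. \<bar>2 * sin (pi * (real k * (w / real n)))\<bar>)" by (rule abs_prod)
    finally have "(exp (K_const * real n) * sin (pi * w)) ^ s \<le> norm (power_prod s n z)"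
      unfolding z_def norm_power_prod_cis using w(3) by (intro power_mono) auto
    also have "\<dots> \<le> (\<Sum>j\<le>D. real_of_int (max_coeff n s))"
      unfolding power_prod_expansion D_def[symmetric]
    proof (rule sum_norm_le)
      fix j assume "j \<in> {..D}"
      then have "\<bar>t_coeff j s n\<bar> \<le> max_coeff n s" unfolding D_def by (intro max_coeff_ge) simp
      then have "real_of_int \<bar>t_coeff j s n\<bar> \<le> real_of_int (max_coeff n s)" by (simp only: of_int_le_iff)
      then show "norm (of_int (t_coeff j s n) * z ^ j) \<le> real_of_int (max_coeff n s)"
        by (simp add: norm_mult norm_power z_def)
    qed
    also have "\<dots> = real (Suc D) * real_of_int (max_coeff n s)" by simp
    also have "\<dots> \<le> (real s + 1) * (real n)\<^sup>2 * real_of_int (max_coeff n s)"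
    proof (rule mult_right_mono)
      have "n + 1 \<le> 2 * n" using n by simp
      then have "s * n * (n + 1) \<le> 2 * (s * n * n)" using mult_le_mono2[of "n + 1" "2 * n" "s * n"] by simp
      then have "D \<le> 2 * (s * n * n) div 2" unfolding D_def by (rule div_le_mono)
      moreover have "1 \<le> n * n" using n by simp
      moreover have "(s + 1) * (n * n) = s * n * n + n * n" by (simp add: algebra_simps)
      ultimately have "Suc D \<le> (s + 1) * (n * n)" by linarith
      then have "real (Suc D) \<le> real ((s + 1) * (n * n))" by (simp only: of_nat_le_iff)
      then show "real (Suc D) \<le> (real s + 1) * (real n)\<^sup>2" by (simp add: power2_eq_square algebra_simps)
    qed (use M0 in simp)
    finally show ?thesis .
  qed
  then show thesis using that w(3) by blast
qed

lemma max_coeff_asymptotics: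
  "\<exists>g :: nat \<Rightarrow> real. g \<in> O(\<lambda>n. ln (real n)) \<and>
     (\<forall>\<^sub>F n in sequentially. real_of_int (max_coeff n s) = exp (real s * K_const * real n + g n))"
proof -
  obtain c where c: "0 < c" "\<And>n s. n > 0 \<Longrightarrow>
    (exp (K_const * real n) * c) ^ s \<le> (real s + 1) * (real n)\<^sup>2 * real_of_int (max_coeff n s)"
    by (rule max_coeff_lower) blast
  define g where "g n = ln (real_of_int (max_coeff n s)) - real s * K_const * real n" for n
  define A where "A = real s * (8000 + \<bar>ln c\<bar>) + ln (real s + 1)"
  define B where "B = real s * 1002 + 2"
  have main: "real_of_int (max_coeff n s) = exp (real s * K_const * real n + g n)
      \<and> \<bar>g n\<bar> \<le> (A + B) * ln (real n)" if n: "10000 \<le> n" for n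
  proof -
    let ?M = "real_of_int (max_coeff n s)"
    have "0 < (exp (K_const * real n) * c) ^ s" using c(1) by simp
    also have lower: "\<dots> \<le> (real s + 1) * (real n)\<^sup>2 * ?M" using n by (intro c(2)) auto
    \<comment> \<open>Positivity makes \<open>exp (ln ?M) = ?M\<close>, so the logarithmic error
      \<open>g\<close> represents the maximum exactly.\<close>
    finally have M: "0 < ?M" by (rule zero_less_mult_pos) (use n in auto)
    have "ln ((exp (K_const * real n) * c) ^ s) \<le> ln ((real s + 1) * (real n)\<^sup>2 * ?M)"
      using lower c(1) by (intro ln_mono) auto
    moreover have "ln ((exp (K_const * real n) * c) ^ s) = real s * (K_const * real n + ln c)"
      using c(1) by (simp add: ln_realpow ln_mult)
    moreover have "ln ((real s + 1) * (real n)\<^sup>2 * ?M) = ln (real s + 1) + 2 * ln (real n) + ln ?M"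
      using M n by (simp add: ln_mult ln_realpow)
    ultimately have g_lower: "real s * ln c - ln (real s + 1) - 2 * ln (real n) \<le> g n"
      by (simp add: g_def algebra_simps)
    have "ln ?M \<le> ln (exp (real s * K_const * real n + real s * (2024 + 1002 * ln (6 * real n))))"
      using max_coeff_upper[OF n, of s] M by (intro ln_mono)
    then have g_upper: "g n \<le> real s * (2024 + 1002 * ln (6 * real n))"
      unfolding ln_exp by (simp add: g_def)
    have "ln (6::real) \<le> 5" using ln_le_minus_one[of "6::real"] by simp
    then have "2024 + 1002 * ln (6 * real n) \<le> 8000 + 1002 * ln (real n)"
      using n by (simp add: ln_mult)
    then have "real s * (2024 + 1002 * ln (6 * real n)) \<le> real s * (8000 + 1002 * ln (real n))"
      by (intro mult_left_mono) auto
    moreover have "0 \<le> ln (real s + 1)" "0 \<le> ln (real n)" "0 \<le> real s * \<bar>ln c\<bar>" using n by auto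
    moreover have "A + B * ln (real n) = real s * (8000 + 1002 * ln (real n))
        + real s * \<bar>ln c\<bar> + ln (real s + 1) + 2 * ln (real n)"
      by (simp add: A_def B_def algebra_simps)
    ultimately have up: "g n \<le> A + B * ln (real n)"
      using g_upper by linarith
    have "- (real s * \<bar>ln c\<bar>) \<le> real s * ln c"
      using mult_left_mono[of "- \<bar>ln c\<bar>" "ln c" "real s"] by simp
    moreover have "0 \<le> real s * ln (real n)" "0 \<le> real s" using n by auto
    ultimately have lo: "- (A + B * ln (real n)) \<le> g n"
      using g_lower by (simp add: A_def B_def algebra_simps)
    \<comment> \<open>From \<open>ln n\<close> at least 1 the additive constant \<open>A\<close> is
      absorbed into a multiple of \<open>ln n\<close>.\<close>
    have "exp 1 \<le> real n" using exp_le n by linarith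
    then have "1 \<le> ln (real n)" using n by (simp add: ln_ge_iff)
    moreover have "0 \<le> A" by (simp add: A_def)
    ultimately have "A * 1 \<le> A * ln (real n)" by (intro mult_left_mono) auto
    then have "\<bar>g n\<bar> \<le> (A + B) * ln (real n)"
      using up lo by (simp add: distrib_right)
    then show ?thesis using M by (simp add: g_def)
  qed
  have "g \<in> O(\<lambda>n. ln (real n))"
  proof (rule bigoI[where c = "A + B"])
    show "\<forall>\<^sub>F n in sequentially. norm (g n) \<le> (A + B) * norm (ln (real n))"
      using eventually_ge_at_top[of 10000]
    proof eventually_elim
      case (elim n)
      then have "0 \<le> ln (real n)" by simp
      then show ?case using main[OF elim] by simp
    qed
  qed
  moreover have "\<forall>\<^sub>F n in sequentially. real_of_int (max_coeff n s) = exp (real s * K_const * real n + g n)"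
    using eventually_ge_at_top[of 10000] by eventually_elim (use main in blast)
  ultimately show ?thesis by blast
qed

theorem theorem4p6:
  shows "(\<exists>w\<in>{1/2<..<1}. \<forall>v\<in>{1/2<..<1}. mean_log_sin v \<le> mean_log_sin w)
    \<and> \<bar>K_const - 0.19861\<bar> < 1 / 10 ^ 5
    \<and> (\<forall>s::nat. s > 0 \<longrightarrow>
          (\<exists>g :: nat \<Rightarrow> real. g \<in> O(\<lambda>n. ln (real n)) \<and>
            (\<forall>\<^sub>F n in sequentially.
               real_of_int (max_coeff n s) = exp (real s * K_const * real n + g n))))"
proof (intro conjI allI impI)
  obtain w where w: "1/2 < w" "w < 9/10"
    "\<And>v. v \<in> {1/2<..<1} \<Longrightarrow> mean_log_sin v \<le> mean_log_sin w"
    by (rule max_point_exists) blast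
  then show "\<exists>w\<in>{1/2<..<1}. \<forall>v\<in>{1/2<..<1}. mean_log_sin v \<le> mean_log_sin w"
    by (intro bexI[of _ w]) auto
  show "\<bar>K_const - 0.19861\<bar> < 1 / 10 ^ 5"
  proof -
    have "K_const < 19862 / 100000" "19860 / 100000 < K_const"
      using K_const_less K_const_greater by simp_all
    then have "\<bar>K_const - 19861 / 100000\<bar> < 1 / 100000" by linarith
    then show ?thesis by simp
  qed
qed (rule max_coeff_asymptotics)

end
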